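(* Let $k \geq 2$ and $d \geq 1$ be integers. Let $p_k(n)$ denote the number of partitions of $n$ in which no part is a multiple of $k$ (with $p_k(0)=1$), so that $\sum_{n\ge 0} p_k(n)q^n = \prod_{n=1}^\infty \frac{1-q^{kn}}{1-q^n}$. Set $m_k = \frac{k-1}{24k}$ and define, for $n \geq 1$, $$A_k(n) = 2\pi \sqrt{m_k/n} + \frac{3}{4}\sum_{r=1}^{\lfloor 3d/4 \rfloor} \frac{(-1)^r}{r n^r}, \qquad \delta_k(n) = \left(- \sum_{r=2}^\infty \frac{4\pi \sqrt{m_k}\binom{1/2}{r}}{n^{r-1/2}} \right)^{1/2}.$$ Let $J^{d,n}_{p_k}(X) = \sum_{j=0}^d \binom{d}{j} p_k(n+j) X^j$ be the Jensen polynomial of degree $d$ and shift $n$ associated to the sequence $p_k$, and define the renormalized Jensen polynomials $$\widehat{J}^{d,n}_{p_k}(X) := \frac{\delta_k(n)^{-d}}{p_k(n)}\, J^{d,n}_{p_k}\!\left( \frac{\delta_k(n)X - 1}{\exp(A_k(n))} \right).$$ Let $H_d(X)$ be the Hermite polynomials defined by the generating function $e^{-t^2+Xt} = \sum_{d=0}^\infty H_d(X)\frac{t^d}{d!}$. Then $$\lim_{n \to \infty} \widehat{J}^{d,n}_{p_k}(X) = H_d(X)$$ uniformly for $X$ in compact subsets of $\mathbb{R}$.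
   Context: $\binom{1/2}{r}$ denotes the generalized binomial coefficient $\frac{(1/2)(1/2-1)\cdots(1/2-r+1)}{r!}$. Note that $A_k(n)$, $\delta_k(n)$ depend on both $k$ and $d$. *)

theory Defs
  imports "HOL-Analysis.Analysis" "HOL-Library.Multiset"
begin

definition regular_partitions :: "nat \<Rightarrow> nat \<Rightarrow> nat multiset set" where
  "regular_partitions k n = {M. sum_mset M = n \<and> (\<forall>x\<in>#M. x > 0 \<and> \<not> k dvd x)}"

definition p_reg :: "nat \<Rightarrow> nat \<Rightarrow> nat" where
  "p_reg k n = card (regular_partitions k n)"

definition m_reg :: "nat \<Rightarrow> real" where
  "m_reg k = (real k - 1) / (24 * real k)"

definition A_reg :: "nat \<Rightarrow> nat \<Rightarrow> nat \<Rightarrow> real" where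
  "A_reg k d n = 2 * pi * sqrt (m_reg k / real n)
     + 3 / 4 * (\<Sum>r = 1..nat \<lfloor>3 * real d / 4\<rfloor>. (-1) ^ r / (real r * real n ^ r))"

text \<open>The series starts at the index 2, hence the shift. For \<open>n \<ge> 1\<close> and \<open>k \<ge> 2\<close> it converges
  to a negative number, so the square root is that of a positive real.\<close>

definition delta_reg :: "nat \<Rightarrow> nat \<Rightarrow> real" where
  "delta_reg k n = sqrt (- (\<Sum>i. let r = i + 2 in
     4 * pi * sqrt (m_reg k) * ((1 / 2) gchoose r) / real n powr (real r - 1 / 2)))"

definition jensen_poly :: "(nat \<Rightarrow> real) \<Rightarrow> nat \<Rightarrow> nat \<Rightarrow> real poly" where
  "jensen_poly a d n = (\<Sum>j\<le>d. monom (real (d choose j) * a (n + j)) j)"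

definition renorm_jensen_poly :: "nat \<Rightarrow> nat \<Rightarrow> nat \<Rightarrow> real poly" where
  "renorm_jensen_poly k d n =
     smult (delta_reg k n powi (- int d) / real (p_reg k n))
       (pcompose (jensen_poly (\<lambda>j. real (p_reg k j)) d n)
          (smult (1 / exp (A_reg k d n)) [:-1, delta_reg k n:]))"

text \<open>The generating function \<open>exp (-t\<^sup>2 + X t)\<close> is read in \<open>\<real>[X][[t]]\<close>: the variable
  \<open>t\<close> is \<^term>\<open>fps_X\<close>, the variable \<open>X\<close> is the polynomial \<open>[:0, 1:]\<close>. The lemma
  \<open>hermite_poly_sums\<close> below is the analytic form of the same identity.\<close>

definition hermite_gf :: "real poly fps" where
  "hermite_gf = Abs_fps (\<lambda>i. [:1 / fact i:]) oo (- (fps_X ^ 2) + fps_const [:0, 1:] * fps_X)"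

definition hermite_poly :: "nat \<Rightarrow> real poly" where
  "hermite_poly d = smult (fact d) (fps_nth hermite_gf d)"

lemma poly_fps_nth_mult:
  fixes f g :: "real poly fps"
  shows "Abs_fps (\<lambda>n. poly (fps_nth (f * g) n) x) =
    Abs_fps (\<lambda>n. poly (fps_nth f n) x) * Abs_fps (\<lambda>n. poly (fps_nth g n) x)"
  by (rule fps_ext) (simp add: fps_mult_nth poly_sum)

lemma poly_fps_nth_power:
  fixes f :: "real poly fps"
  shows "Abs_fps (\<lambda>n. poly (fps_nth (f ^ i) n) x) = Abs_fps (\<lambda>n. poly (fps_nth f n) x) ^ i"
proof (induction i)
  case 0
  show ?case by (rule fps_ext) simp
next
  case (Suc i)
  then show ?case by (simp add: poly_fps_nth_mult)
qed

lemma poly_hermite_poly: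
  "poly (hermite_poly d) x / fact d =
    fps_nth (fps_exp 1 oo (- (fps_X ^ 2) + fps_const x * fps_X)) d"
proof -
  let ?u = "- (fps_X ^ 2) + fps_const [:0, 1:] * fps_X :: real poly fps"
  have u: "Abs_fps (\<lambda>n. poly (fps_nth ?u n) x) = - (fps_X ^ 2) + fps_const x * fps_X"
    by (rule fps_ext) (simp add: fps_X_power_nth fps_X_nth)
  have "poly (fps_nth (?u ^ i) d) x = fps_nth ((- (fps_X ^ 2) + fps_const x * fps_X) ^ i) d" for i
    using arg_cong[OF poly_fps_nth_power[of ?u i x], of "\<lambda>f. fps_nth f d"]
    unfolding u by simp
  then show ?thesis
    by (simp add: hermite_poly_def hermite_gf_def fps_compose_nth poly_sum)
qed

lemma fps_exp_compose_split:
  "fps_exp 1 oo (- (fps_X ^ 2) + fps_const x * fps_X) =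
    fps_exp x * (fps_exp (-1) oo (fps_X ^ 2 :: real fps))" (is "?F = ?G")
proof -
  have unique: "F = G"
    if "fps_deriv F = (fps_const x - 2 * fps_X) * F" "fps_deriv G = (fps_const x - 2 * fps_X) * G"
      "fps_nth F 0 = fps_nth G 0" for F G :: "real fps"
  proof -
    define D where "D = F - G"
    have D: "fps_deriv D = fps_const x * D - fps_const 2 * (fps_X * D)" "fps_nth D 0 = 0"
      using that by (simp_all add: D_def algebra_simps numeral_fps_const)
    have "fps_nth D n = 0" for n
    proof (induction n rule: less_induct)
      case (less n)
      show ?case
      proof (cases n)
        case (Suc m)
        have "real (Suc m) * fps_nth D (Suc m) = fps_nth (fps_deriv D) m"
          by simp
        also have "\<dots> = 0"
          using less Suc by (simp add: D(1))
        finally show ?thesis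
          using Suc by simp
      qed (use D(2) in simp)
    qed
    then have "D = 0"
      by (simp add: fps_eq_iff)
    then show ?thesis
      by (simp add: D_def)
  qed
  show ?thesis
  proof (rule unique)
    have "fps_deriv ?F = (fps_deriv (fps_exp 1) oo (- (fps_X ^ 2) + fps_const x * fps_X)) *
        fps_deriv (- (fps_X ^ 2) + fps_const x * fps_X)"
      by (rule fps_compose_deriv) simp
    then show "fps_deriv ?F = (fps_const x - 2 * fps_X) * ?F"
      by (simp add: fps_deriv_power algebra_simps numeral_fps_const)
    have "fps_deriv (fps_exp (-1) oo (fps_X ^ 2 :: real fps)) =
        (fps_deriv (fps_exp (-1)) oo (fps_X ^ 2)) * fps_deriv (fps_X ^ 2)"
      by (rule fps_compose_deriv) simp
    also have "\<dots> = - 2 * fps_X * (fps_exp (-1) oo (fps_X ^ 2))"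
      by (simp add: fps_deriv_power fps_compose_uminus numeral_fps_const
          flip: fps_const_neg)
    finally show "fps_deriv ?G = (fps_const x - 2 * fps_X) * ?G"
      by (simp add: algebra_simps)
    show "fps_nth ?F 0 = fps_nth ?G 0"
      by (simp add: fps_compose_nth)
  qed
qed

lemma hermite_poly_sums:
  "(\<lambda>d. poly (hermite_poly d) x * t ^ d / fact d) sums exp (- t\<^sup>2 + x * t)"
proof -
  let ?S = "fps_exp (-1) oo (fps_X ^ 2) :: real fps"
  have S_nth: "fps_nth ?S n = (if even n then (-1) ^ (n div 2) / fact (n div 2) else 0)" for n
  proof -
    have "fps_nth ?S n = (\<Sum>i=0..n. if n = 2 * i then (-1) ^ i / fact i else 0)"
      by (simp add: fps_compose_nth fps_X_power_nth flip: power_mult) (rule sum.cong, auto)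
    also have "\<dots> = (if even n then (-1) ^ (n div 2) / fact (n div 2) else 0)"
    proof (cases "even n")
      case True
      then obtain m where m: "n = 2 * m" by blast
      show ?thesis unfolding m by (simp add: sum.delta)
    next
      case False
      then show ?thesis by (intro trans[OF sum.neutral]) auto
    qed
    finally show ?thesis .
  qed
  have S_sums: "(\<lambda>n. fps_nth ?S n * z ^ n) sums exp (- z\<^sup>2)" for z
  proof -
    have "(\<lambda>m. (- z\<^sup>2) ^ m /\<^sub>R fact m) sums exp (- z\<^sup>2)"
      by (rule exp_converges)
    also have "(\<lambda>m. (- z\<^sup>2) ^ m /\<^sub>R fact m) = (\<lambda>m. fps_nth ?S (2 * m) * z ^ (2 * m))"
      by (simp add: S_nth fun_eq_iff power_minus[of "z\<^sup>2"] field_simps power_mult[symmetric])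
    finally show ?thesis
      by (subst (asm) sums_mono_reindex[of "\<lambda>m. 2 * m" "\<lambda>n. fps_nth ?S n * z ^ n"])
        (auto simp: strict_mono_def S_nth elim!: evenE)
  qed
  have radius: "fps_conv_radius ?S = \<infinity>"
    unfolding fps_conv_radius_def
    by (rule conv_radius_inftyI'') (use S_sums sums_summable in blast)
  have "(\<lambda>d. fps_nth (fps_exp x * ?S) d * t ^ d) sums eval_fps (fps_exp x * ?S) t"
    using fps_conv_radius_mult[of "fps_exp x" ?S] by (intro sums_eval_fps) (simp add: radius)
  also have "eval_fps (fps_exp x * ?S) t = exp (x * t) * exp (- t\<^sup>2)"
    using S_sums[of t] by (simp add: eval_fps_mult radius) (simp add: eval_fps_def sums_iff)
  also have "\<dots> = exp (- t\<^sup>2 + x * t)"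
    by (simp add: exp_add[symmetric] algebra_simps)
  finally have "(\<lambda>d. poly (hermite_poly d) x / fact d * t ^ d) sums exp (- t\<^sup>2 + x * t)"
    unfolding fps_exp_compose_split[symmetric] poly_hermite_poly[symmetric] .
  then show ?thesis
    by simp
qed

end

theory Submission
  imports Defs "HOL-Probability.Probability" "HOL-Real_Asymp.Real_Asymp"
    "HOL-Computational_Algebra.Formal_Laurent_Series"
begin

text \<open>
  Writing \<open>P(q) = \<Sum> p\<^sub>k(n) q\<^sup>n\<close>, Cauchy's formula on the circle \<open>q = exp (-z)\<close>, \<open>z = x + iy\<close>, turns the
  renormalized Jensen polynomial into a quotient of the integrals of
  \<open>P(exp (-z)) exp (nz) (X exp (z - A) + (1 - exp (z - A)) / \<delta>)\<^sup>d\<close> and \<open>P(exp (-z)) exp (nz)\<close> over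
  \<open>\<bar>y\<bar> \<le> \<pi>\<close>. On the saddle \<open>x = 2\<pi> sqrt (m / n)\<close> and at the scale \<open>y = 2 \<delta> u\<close> the
  function \<open>P(exp (-z)) exp (nz)\<close> is asymptotically a constant times \<open>exp (-u\<^sup>2)\<close>, while \<open>(1 - exp (z - A)) / \<delta>\<close>
  tends to \<open>-2iu\<close>; the limit is the Gaussian mean of \<open>(X - 2iu)\<^sup>d\<close>, which is \<open>H\<^sub>d(X)\<close>.

  Since only a quotient is needed, no modular transformation of \<open>P\<close> is used. Near the real axis
  \<open>ln P(exp (-z)) = \<Sum>\<^sub>m (1 / (exp (mz) - 1) - 1 / (exp (kmz) - 1)) / m\<close> differs from \<open>4\<pi>\<^sup>2 m\<^sub>k / z\<close> by a function
  that varies slowly enough, and away from it the factors \<open>1 + w + \<dots> + w\<^sup>k\<^sup>-\<^sup>1\<close> of \<open>P\<close> provide one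
  bound that dominates the integrand on the whole circle.
\<close>

section \<open>Partitions with parts in a prescribed set\<close>

text \<open>The scales explain why crude estimates suffice. With c = 4 \<pi>^2 m, the saddle
  satisfies n x^2 = c, and \<delta>^2 is asymptotic to x^3 / (4 c). So a fixed u corresponds to y of
  order x^(3/2), deep inside the sector \<bar>y\<bar> \<le> x, and an error of the form
  \<bar>y\<bar> x^(-e) with e < 3/2 already vanishes in the limit. The size of P(exp (-x)) is never
  estimated: it is a common factor of all the integrals.

  The obstacle is domination. On the circle u runs up to order x^(-3/2), so powers of (1 - exp (z -
  A)) / \<delta> can be as large as powers of 1 / x. They are absorbed by a decay that holds for
  every \<bar>y\<bar> \<le> \<pi>, namely exp (-c' E) with E = y^2 / (x (x^2 + y^2)) and a constant
  c' > 0. This E behaves like u^2 near the axis and like 1 / x away from it, and it beats every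
  power of u in both ranges.\<close>

definition partitions_in :: "nat set \<Rightarrow> nat \<Rightarrow> nat multiset set" where
  "partitions_in S n = {M. set_mset M \<subseteq> S \<and> sum_mset M = n}"

lemma partitions_in_empty: "partitions_in {} n = (if n = 0 then {{#}} else {})"
  by (auto simp: partitions_in_def)

lemma finite_partitions_in:
  assumes "0 \<notin> S"
  shows "finite (partitions_in S n)"
proof (induction n rule: less_induct)
  case (less n)
  have "partitions_in S n \<subseteq> insert {#} (\<Union>a\<in>{1..n}. add_mset a ` partitions_in S (n - a))"
  proof
    fix M assume M: "M \<in> partitions_in S n"
    show "M \<in> insert {#} (\<Union>a\<in>{1..n}. add_mset a ` partitions_in S (n - a))"
    proof (cases M)
      case (add a N)
      then have "a \<in> S" "n = a + sum_mset N"
        using M by (auto simp: partitions_in_def)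
      then have "a \<in> {1..n}" "N \<in> partitions_in S (n - a)"
        using M add assms by (auto simp: partitions_in_def Suc_le_eq intro: gr0I)
      then show ?thesis using add by blast
    qed simp
  qed
  moreover have "finite (insert {#} (\<Union>a\<in>{1..n}. add_mset a ` partitions_in S (n - a)))"
    using less.IH by auto
  ultimately show ?case
    by (rule finite_subset)
qed

text \<open>Partitions that contain \<open>a\<close> lose one copy of it and may still contain
  others, hence \<open>insert a S\<close> on the right. In terms of generating functions this is
  F(insert a S) (1 - q^a) = F(S).\<close>

lemma card_partitions_in_insert:
  assumes "0 \<notin> insert a S" "a \<notin> S"
  shows "card (partitions_in (insert a S) n) = card (partitions_in S n) +
    (if a \<le> n then card (partitions_in (insert a S) (n - a)) else 0)"
proof -
  let ?B = "if a \<le> n then add_mset a ` partitions_in (insert a S) (n - a) else {}"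
  have "partitions_in (insert a S) n = partitions_in S n \<union> ?B"
  proof (intro set_eqI iffI)
    fix M assume M: "M \<in> partitions_in (insert a S) n"
    show "M \<in> partitions_in S n \<union> ?B"
    proof (cases "a \<in># M")
      case True
      then obtain N where N: "M = add_mset a N"
        by (metis insert_DiffM)
      then have "a \<le> n" "N \<in> partitions_in (insert a S) (n - a)"
        using M by (auto simp: partitions_in_def)
      then show ?thesis using N by auto
    qed (use M in \<open>auto simp: partitions_in_def\<close>)
  qed (auto simp: partitions_in_def split: if_splits)
  moreover have "a \<in># M" if "M \<in> ?B" for M
    using that by (auto split: if_splits)
  then have "partitions_in S n \<inter> ?B = {}"
    using assms(2) unfolding partitions_in_def by blast
  moreover have "card ?B = (if a \<le> n then card (partitions_in (insert a S) (n - a)) else 0)"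
    by (simp add: card_image inj_on_def)
  moreover have "finite (partitions_in S n)" "finite ?B"
    using finite_partitions_in[of S] finite_partitions_in[OF assms(1)] assms(1) by auto
  ultimately show ?thesis
    by (simp only: card_Un_disjoint)
qed

text \<open>The previous recurrence unrolled: \<open>i\<close> is the total taken up by the copies
  of \<open>a\<close>. In this form the counts are a Cauchy product with the coefficients of 1 / (1
  - q^a).\<close>

lemma card_partitions_in_insert_sum:
  assumes "0 \<notin> insert a S" "a \<notin> S"
  shows "card (partitions_in (insert a S) n) =
    (\<Sum>i\<le>n. if a dvd i then card (partitions_in S (n - i)) else 0)"
proof (induction n rule: less_induct)
  case (less n)
  have a: "a > 0" using assms by (intro gr0I) auto
  show ?case
  proof (cases "a \<le> n")
    case True
    have "(\<Sum>i\<le>n. if a dvd i then card (partitions_in S (n - i)) else 0) =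
        (\<Sum>i\<in>{..<a}. if a dvd i then card (partitions_in S (n - i)) else 0) +
        (\<Sum>i\<in>{a..n}. if a dvd i then card (partitions_in S (n - i)) else 0)"
      by (subst sum.union_disjoint[symmetric]) (use True in \<open>auto intro!: sum.cong\<close>)
    also have "(\<Sum>i\<in>{..<a}. if a dvd i then card (partitions_in S (n - i)) else 0) =
        (\<Sum>i\<in>{0}. if a dvd i then card (partitions_in S (n - i)) else 0)"
      by (rule sum.mono_neutral_right) (use a in \<open>auto dest: dvd_imp_le\<close>)
    also have "(\<Sum>i\<in>{a..n}. if a dvd i then card (partitions_in S (n - i)) else 0) =
        (\<Sum>i\<le>n - a. if a dvd i then card (partitions_in S (n - a - i)) else 0)"
      by (rule sum.reindex_bij_witness[of _ "\<lambda>i. i + a" "\<lambda>i. i - a"])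
        (use True in \<open>auto simp: dvd_diff_nat dest: dvd_diffD\<close>)
    also have "\<dots> = card (partitions_in (insert a S) (n - a))"
      using less.IH[of "n - a"] a True by simp
    finally show ?thesis
      using card_partitions_in_insert[OF assms, of n] True by simp
  next
    case False
    have "(\<Sum>i\<le>n. if a dvd i then card (partitions_in S (n - i)) else 0) =
        (\<Sum>i\<in>{0}. if a dvd i then card (partitions_in S (n - i)) else 0)"
      by (rule sum.mono_neutral_right) (use False in \<open>auto dest: dvd_imp_le\<close>)
    then show ?thesis
      using card_partitions_in_insert[OF assms, of n] False by simp
  qed
qed

lemma multiples_sums:
  fixes q :: "'a :: {real_normed_field, banach}"
  assumes "norm q < 1" "a > 0"
  shows "summable (\<lambda>n. norm (if a dvd n then q ^ n else 0))"
    and "(\<lambda>n. if a dvd n then q ^ n else 0) sums (1 / (1 - q ^ a))"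
proof -
  have qa: "norm (q ^ a) < 1"
    using assms by (simp add: norm_power power_less_one_iff)
  have reidx: "strict_mono (\<lambda>m. a * m)"
    using assms by (auto simp: strict_mono_def)
  have rng: "n \<in> range ((*) a) \<longleftrightarrow> a dvd n" for n
    by auto
  show "(\<lambda>n. if a dvd n then q ^ n else 0) sums (1 / (1 - q ^ a))"
    using geometric_sums[OF qa]
    by (subst sums_mono_reindex[OF reidx, symmetric]) (simp_all add: rng power_mult)
  show "summable (\<lambda>n. norm (if a dvd n then q ^ n else 0))"
    using summable_geometric[of "norm (q ^ a)"] qa
    by (subst summable_mono_reindex[OF reidx, symmetric]) (simp_all add: rng power_mult norm_power)
qed

lemma partitions_in_sums:
  fixes q :: "'a :: {real_normed_field, banach}"
  assumes "finite S" "0 \<notin> S" "norm q < 1"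
  shows "summable (\<lambda>n. norm (of_nat (card (partitions_in S n)) * q ^ n))"
    and "(\<lambda>n. of_nat (card (partitions_in S n)) * q ^ n) sums (\<Prod>a\<in>S. 1 / (1 - q ^ a))"
proof -
  have "summable (\<lambda>n. norm (of_nat (card (partitions_in S n)) * q ^ n)) \<and>
      (\<lambda>n. of_nat (card (partitions_in S n)) * q ^ n) sums (\<Prod>a\<in>S. 1 / (1 - q ^ a))"
    if "norm q < 1" for q :: "'b :: {real_normed_field, banach}"
    using assms(1,2)
  proof (induction S rule: finite_induct)
    case empty
    have "(\<lambda>n. of_nat (card (partitions_in {} n)) * q ^ n) = (\<lambda>n. if n = 0 then 1 else 0)"
      by (auto simp: partitions_in_empty fun_eq_iff)
    moreover have "(\<lambda>n. norm (of_nat (card (partitions_in {} n)) * q ^ n)) = (\<lambda>n. if n = 0 then 1 else 0)"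
      by (auto simp: partitions_in_empty fun_eq_iff)
    ultimately show ?case
      using sums_single[of 0 "\<lambda>_. 1 :: 'b"] sums_single[of 0 "\<lambda>_. 1 :: real"]
      by (simp add: sums_iff)
  next
    case (insert a S)
    then have a: "a > 0" by (intro gr0I) auto
    define c where "c n = (of_nat (card (partitions_in S n)) * q ^ n)" for n
    define e where "e n = (if a dvd n then q ^ n else 0)" for n
    have c: "summable (\<lambda>n. norm (c n))" "c sums (\<Prod>a\<in>S. 1 / (1 - q ^ a))"
      using insert by (auto simp: c_def[abs_def])
    have e: "summable (\<lambda>n. norm (e n))" "e sums (1 / (1 - q ^ a))"
      using multiples_sums[OF that a] by (simp_all add: e_def[abs_def])
    \<comment> \<open>Stated over an arbitrary field so that it can be used twice: at
      \<open>q\<close> for the value of the sum, and at \<open>norm q\<close> for absolute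
      convergence.\<close>
    have eq: "of_nat (card (partitions_in (insert a S) n)) * q ^ n = (\<Sum>i\<le>n. e i * c (n - i))"
      if "\<And>n. c n = of_nat (card (partitions_in S n)) * q ^ n" "\<And>n. e n = (if a dvd n then q ^ n else 0)"
      for n and q :: "'c :: real_normed_field" and c e
    proof -
      have "of_nat (card (partitions_in (insert a S) n)) * q ^ n =
          (\<Sum>i\<le>n. of_nat (if a dvd i then card (partitions_in S (n - i)) else 0) * q ^ n)"
        using insert.hyps insert.prems
        by (subst card_partitions_in_insert_sum) (auto simp only: sum_distrib_right of_nat_sum)
      also have "\<dots> = (\<Sum>i\<le>n. e i * c (n - i))"
        by (rule sum.cong) (auto simp: that power_add[symmetric])
      finally show ?thesis .
    qed
    have eq1: "of_nat (card (partitions_in (insert a S) n)) * q ^ n = (\<Sum>i\<le>n. e i * c (n - i))" for n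
      by (rule eq) (auto simp: c_def e_def)
    have eq2: "norm (of_nat (card (partitions_in (insert a S) n)) * q ^ n) =
        (\<Sum>i\<le>n. norm (e i) * norm (c (n - i)))" for n
      unfolding norm_mult norm_power norm_of_nat
      by (rule eq) (auto simp: c_def e_def norm_mult norm_power)
    have "summable (\<lambda>n. norm (of_nat (card (partitions_in (insert a S) n)) * q ^ n))"
      unfolding eq2 using e(1) c(1) by (intro summable_Cauchy_product) auto
    moreover have "(\<lambda>n. of_nat (card (partitions_in (insert a S) n)) * q ^ n) sums
        (1 / (1 - q ^ a) * (\<Prod>a\<in>S. 1 / (1 - q ^ a)))"
      using Cauchy_product_sums[OF e(1) c(1)] e(2) c(2) unfolding eq1 by (simp add: sums_iff)
    ultimately show ?case
      using insert.hyps by simp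
  qed
  then show "summable (\<lambda>n. norm (of_nat (card (partitions_in S n)) * q ^ n))"
    "(\<lambda>n. of_nat (card (partitions_in S n)) * q ^ n) sums (\<Prod>a\<in>S. 1 / (1 - q ^ a))"
    using assms(3) by blast+
qed

section \<open>The generating function of the partitions without multiples of k, as a limit of
  finite products\<close>

definition regular_parts :: "nat \<Rightarrow> nat \<Rightarrow> nat set" where
  "regular_parts k N = {n \<in> {1..N}. \<not> k dvd n}"

lemma finite_regular_parts [simp]: "finite (regular_parts k N)"
  and zero_notin_regular_parts [simp]: "0 \<notin> regular_parts k N"
  by (auto simp: regular_parts_def)

lemma partitions_in_regular_parts_subset: "partitions_in (regular_parts k N) n \<subseteq> regular_partitions k n"
  by (fastforce simp: partitions_in_def regular_partitions_def regular_parts_def)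

lemma regular_partitions_eq:
  assumes "n \<le> N"
  shows "regular_partitions k n = partitions_in (regular_parts k N) n"
proof
  have "x \<le> n" if "M \<in> regular_partitions k n" "x \<in># M" for M x
    using that by (auto simp: regular_partitions_def dest!: multi_member_split)
  then show "regular_partitions k n \<subseteq> partitions_in (regular_parts k N) n"
    using assms by (fastforce simp: partitions_in_def regular_partitions_def regular_parts_def Suc_le_eq)
qed (rule partitions_in_regular_parts_subset)

lemma p_reg_eq: "n \<le> N \<Longrightarrow> p_reg k n = card (partitions_in (regular_parts k N) n)"
  by (simp add: p_reg_def regular_partitions_eq)

lemma card_partitions_in_le_p_reg: "card (partitions_in (regular_parts k N) n) \<le> p_reg k n"
  unfolding p_reg_def
  by (intro card_mono partitions_in_regular_parts_subset)
    (simp add: regular_partitions_eq[of n n] finite_partitions_in)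

text \<open>Each factor satisfies 1 / (1 - t) \<le> 1 + t / (1 - r) \<le> exp (t / (1 - r)) for t =
  r^a \<le> r, and the exponents sum to at most a geometric series. What matters is that the bound
  does not depend on \<open>N\<close>.\<close>

lemma prod_regular_parts_le:
  fixes r :: real
  assumes "0 \<le> r" "r < 1"
  shows "(\<Prod>a\<in>regular_parts k N. 1 / (1 - r ^ a)) \<le> exp (1 / (1 - r)\<^sup>2)"
proof -
  have "(\<Prod>a\<in>regular_parts k N. 1 / (1 - r ^ a)) \<le> (\<Prod>a\<in>regular_parts k N. exp (r ^ a / (1 - r)))"
  proof (intro prod_mono conjI)
    fix a assume "a \<in> regular_parts k N"
    then have "a > 0" by (auto simp: regular_parts_def)
    then have ra: "r ^ a \<le> r" "0 \<le> r ^ a"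
      using assms power_decreasing[of 1 a r] by (auto simp: Suc_le_eq)
    then have "1 - r ^ a > 0" using assms by linarith
    then have "1 / (1 - r ^ a) = 1 + r ^ a / (1 - r ^ a)"
      by (simp add: field_simps)
    also have "\<dots> \<le> 1 + r ^ a / (1 - r)"
      using ra assms by (intro add_left_mono divide_left_mono) auto
    also have "\<dots> \<le> exp (r ^ a / (1 - r))"
      by (rule exp_ge_add_one_self)
    finally show "1 / (1 - r ^ a) \<le> exp (r ^ a / (1 - r))" .
    show "0 \<le> 1 / (1 - r ^ a)"
      using \<open>1 - r ^ a > 0\<close> by simp
  qed
  also have "\<dots> = exp ((\<Sum>a\<in>regular_parts k N. r ^ a) / (1 - r))"
    by (simp add: exp_sum sum_divide_distrib)
  also have "(\<Sum>a\<in>regular_parts k N. r ^ a) \<le> (\<Sum>a. r ^ a)"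
    using assms by (intro sum_le_suminf) (auto simp: summable_geometric)
  also have "(\<Sum>a. r ^ a) = 1 / (1 - r)"
    using assms by (simp add: suminf_geometric)
  finally show ?thesis
    using assms by (simp add: divide_right_mono power2_eq_square)
qed

text \<open>For n < N the counts with parts bounded by \<open>N\<close> are already the true ones,
  so each partial sum lies below a finite product, and these products are bounded uniformly.\<close>

lemma summable_p_reg:
  fixes r :: real
  assumes "0 \<le> r" "r < 1"
  shows "summable (\<lambda>n. real (p_reg k n) * r ^ n)"
proof (rule summableI_nonneg_bounded)
  fix N
  have "(\<Sum>n<N. real (p_reg k n) * r ^ n) = (\<Sum>n<N. real (card (partitions_in (regular_parts k N) n)) * r ^ n)"
    by (intro sum.cong) (auto simp: p_reg_eq[of _ N])
  also have "\<dots> \<le> (\<Sum>n. real (card (partitions_in (regular_parts k N) n)) * r ^ n)"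
    using partitions_in_sums(2)[of "regular_parts k N" r] assms
    by (intro sum_le_suminf) (auto simp: sums_iff)
  also have "\<dots> = (\<Prod>a\<in>regular_parts k N. 1 / (1 - r ^ a))"
    using partitions_in_sums(2)[of "regular_parts k N" r] assms by (simp add: sums_iff)
  also have "\<dots> \<le> exp (1 / (1 - r)\<^sup>2)"
    by (rule prod_regular_parts_le[OF assms])
  finally show "(\<Sum>n<N. real (p_reg k n) * r ^ n) \<le> exp (1 / (1 - r)\<^sup>2)" .
qed (use assms in auto)

definition p_reg_gf :: "nat \<Rightarrow> complex \<Rightarrow> complex" where
  "p_reg_gf k q = (\<Sum>n. of_nat (p_reg k n) * q ^ n)"

lemma p_reg_gf_sums:
  assumes "norm q < 1"
  shows "(\<lambda>n. of_nat (p_reg k n) * q ^ n) sums p_reg_gf k q"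
  unfolding p_reg_gf_def
  by (rule summable_sums, rule summable_norm_cancel)
    (use summable_p_reg[of "norm q" k] assms in \<open>simp add: norm_mult norm_power\<close>)

lemma p_reg_gf_of_real:
  assumes "0 \<le> r" "r < 1"
  shows "p_reg_gf k (of_real r) = of_real (\<Sum>n. real (p_reg k n) * r ^ n)"
  unfolding p_reg_gf_def
  by (subst suminf_of_real[OF summable_p_reg[OF assms]]) simp

lemma p_reg_gf_of_real_nonzero:
  assumes "0 \<le> r" "r < 1"
  shows "p_reg_gf k (of_real r) \<noteq> 0"
proof -
  have "(\<Sum>n\<in>{0}. real (p_reg k n) * r ^ n) \<le> (\<Sum>n. real (p_reg k n) * r ^ n)"
    using assms summable_p_reg[OF assms] by (intro sum_le_suminf) auto
  moreover have "regular_partitions k 0 = {{#}}"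
    by (simp add: regular_partitions_eq[of 0 0] regular_parts_def partitions_in_empty)
  ultimately have "(\<Sum>n. real (p_reg k n) * r ^ n) \<ge> 1"
    by (simp add: p_reg_def)
  then show ?thesis
    by (auto simp: p_reg_gf_of_real[OF assms])
qed

text \<open>Every coefficient is eventually constant in \<open>N\<close> and never exceeds
  \<open>p_reg k n\<close>, so Tannery's theorem applies with the convergent series at
  \<open>norm q\<close> as majorant.\<close>

lemma p_reg_gf_prod_tendsto:
  assumes "norm q < 1"
  shows "(\<lambda>N. \<Prod>a\<in>regular_parts k N. 1 / (1 - q ^ a)) \<longlonglongrightarrow> p_reg_gf k q"
proof -
  have "(\<lambda>N. \<Sum>n. of_nat (card (partitions_in (regular_parts k N) n)) * q ^ n) \<longlonglongrightarrow> p_reg_gf k q"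
    unfolding p_reg_gf_def
  proof (rule tannerys_theorem[THEN conjunct2, THEN conjunct2])
    show "(\<lambda>N. of_nat (card (partitions_in (regular_parts k N) n)) * q ^ n) \<longlonglongrightarrow> of_nat (p_reg k n) * q ^ n" for n
      by (rule tendsto_eventually) (auto intro!: eventually_sequentiallyI[of n] simp: p_reg_eq[of n])
    show "\<forall>\<^sub>F (n, N) in at_top \<times>\<^sub>F sequentially.
        norm (of_nat (card (partitions_in (regular_parts k N) n)) * q ^ n) \<le> real (p_reg k n) * norm q ^ n"
      using card_partitions_in_le_p_reg
      by (intro always_eventually) (simp add: norm_mult norm_power mult_right_mono)
    show "summable (\<lambda>n. real (p_reg k n) * norm q ^ n)"
      using assms by (intro summable_p_reg) auto
  qed auto
  also have "(\<lambda>N. \<Sum>n. of_nat (card (partitions_in (regular_parts k N) n)) * q ^ n) =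
      (\<lambda>N. \<Prod>a\<in>regular_parts k N. 1 / (1 - q ^ a))"
    using partitions_in_sums(2)[OF _ _ assms] by (auto simp: sums_iff fun_eq_iff)
  finally show ?thesis .
qed

section \<open>Decay of the generating function away from the positive axis\<close>

text \<open>Truncating at a multiple of \<open>k\<close> pairs each n \<le> M with its multiple k n,
  and (1 - q^(k n)) / (1 - q^n) is a finite geometric sum. The indices between \<open>M\<close> and
  \<open>k * M\<close> stay unpaired and form the last product.\<close>

lemma prod_regular_parts_mult:
  fixes q :: "'a :: real_normed_field"
  assumes "norm q < 1" "k > 0"
  shows "(\<Prod>a\<in>regular_parts k (k * M). 1 / (1 - q ^ a)) =
    (\<Prod>n=1..M. \<Sum>i<k. (q ^ n) ^ i) * (\<Prod>n\<in>{M<..k * M}. 1 / (1 - q ^ n))"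
proof -
  have q1: "q ^ n \<noteq> 1" if "n > 0" for n
    using power_eq_1_iff[of q n] assms that by (metis less_irrefl norm_one power_less_one_iff norm_ge_zero norm_power)
  \<comment> \<open>Multiplying by the factors at the multiples of \<open>k\<close> completes the
    index set to \<open>{1..k * M}\<close>; this nonzero product is cancelled at the end.\<close>
  have "(\<Prod>a\<in>regular_parts k (k * M). 1 / (1 - q ^ a)) * (\<Prod>n=1..M. 1 / (1 - q ^ (k * n))) =
      (\<Prod>a\<in>regular_parts k (k * M). 1 / (1 - q ^ a)) * (\<Prod>a\<in>(\<lambda>n. k * n) ` {1..M}. 1 / (1 - q ^ a))"
    using assms by (subst prod.reindex) (auto simp: inj_on_def)
  also have "\<dots> = (\<Prod>n\<in>regular_parts k (k * M) \<union> (\<lambda>n. k * n) ` {1..M}. 1 / (1 - q ^ n))"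
    by (rule prod.union_disjoint[symmetric]) (auto simp: regular_parts_def)
  also have "regular_parts k (k * M) \<union> (\<lambda>n. k * n) ` {1..M} = {1..k * M}"
    using assms by (auto simp: regular_parts_def Suc_le_eq elim!: dvdE)
  also have "{1..k * M} = {1..M} \<union> {M<..k * M}"
  proof -
    have "x \<le> k * M" if "x \<le> M" for x
      using le_trans[OF that, of "k * M"] assms by simp
    then show ?thesis by auto
  qed
  also have "(\<Prod>n\<in>{1..M} \<union> {M<..k * M}. 1 / (1 - q ^ n)) =
      (\<Prod>n=1..M. 1 / (1 - q ^ n)) * (\<Prod>n\<in>{M<..k * M}. 1 / (1 - q ^ n))"
    by (rule prod.union_disjoint) auto
  also have "(\<Prod>n=1..M. 1 / (1 - q ^ n)) =
      (\<Prod>n=1..M. (\<Sum>i<k. (q ^ n) ^ i) * (1 / (1 - q ^ (k * n))))"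
  proof (rule prod.cong)
    fix n assume "n \<in> {1..M}"
    then have "q ^ n \<noteq> 1" "q ^ (k * n) \<noteq> 1"
      using q1 assms by auto
    moreover from this have "(\<Sum>i<k. (q ^ n) ^ i) = (1 - q ^ (k * n)) / (1 - q ^ n)"
      by (subst sum_gp_strict) (simp add: power_mult[symmetric] mult.commute)
    ultimately show "1 / (1 - q ^ n) = (\<Sum>i<k. (q ^ n) ^ i) * (1 / (1 - q ^ (k * n)))"
      by simp
  qed simp
  also have "\<dots> = (\<Prod>n=1..M. \<Sum>i<k. (q ^ n) ^ i) * (\<Prod>n=1..M. 1 / (1 - q ^ (k * n)))"
    by (rule prod.distrib)
  finally have "(\<Prod>a\<in>regular_parts k (k * M). 1 / (1 - q ^ a)) * (\<Prod>n=1..M. 1 / (1 - q ^ (k * n))) =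
    ((\<Prod>n=1..M. \<Sum>i<k. (q ^ n) ^ i) * (\<Prod>n\<in>{M<..k * M}. 1 / (1 - q ^ n))) *
      (\<Prod>n=1..M. 1 / (1 - q ^ (k * n)))"
    by (simp only: mult_ac)
  moreover have "(\<Prod>n=1..M. 1 / (1 - q ^ (k * n))) \<noteq> 0"
    using q1 assms by (auto simp: eq_commute[of 1])
  ultimately show ?thesis
    by (simp only: mult_cancel_right) auto
qed

text \<open>The gain comes from the first two terms alone: (1 + \<rho>)^2 - \<bar>1 + w\<bar>^2 = 2
  (\<rho> - Re w), and 1 + \<rho> + \<bar>1 + w\<bar> \<le> 4, so \<bar>1 + w\<bar> falls short of 1
  + \<rho> by at least (\<rho> - Re w) / 2. The remaining terms are bounded by their moduli.\<close>

lemma norm_geometric_sum_le: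
  fixes w :: complex
  assumes "norm w < 1" "k \<ge> 2"
  shows "norm (\<Sum>i<k. w ^ i) \<le> (\<Sum>i<k. norm w ^ i) * exp (- (norm w - Re w) / (2 * k))"
proof -
  define \<rho> where "\<rho> = norm w"
  have \<rho>: "0 \<le> \<rho>" "\<rho> < 1" "Re w \<le> \<rho>" "norm (1 + w) \<le> 1 + \<rho>"
    using assms norm_triangle_ineq[of 1 w] by (auto simp: \<rho>_def complex_Re_le_cmod)
  define S where "S = (\<Sum>i<k. \<rho> ^ i)"
  have k: "{..<k} = {0, 1} \<union> {2..<k}"
    using assms by auto
  have split: "(\<Sum>i<k. v ^ i) = 1 + v + (\<Sum>i\<in>{2..<k}. v ^ i)" for v :: "'b :: comm_ring_1"
    unfolding k by (subst sum.union_disjoint) auto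
  have "2 * (\<rho> - Re w) = (1 + \<rho>)\<^sup>2 - (norm (1 + w))\<^sup>2"
    by (simp add: cmod_power2 \<rho>_def power2_eq_square[of "1 + _"] algebra_simps)
      (simp add: cmod_power2 power2_eq_square[symmetric])
  also have "(1 + \<rho>)\<^sup>2 - (norm (1 + w))\<^sup>2 = (1 + \<rho> - norm (1 + w)) * (1 + \<rho> + norm (1 + w))"
    by (simp add: power2_eq_square algebra_simps)
  also have "\<dots> \<le> (1 + \<rho> - norm (1 + w)) * 4"
    using \<rho> by (intro mult_left_mono) auto
  finally have 1: "norm (1 + w) \<le> 1 + \<rho> - (\<rho> - Re w) / 2"
    by (simp add: field_simps)
  have "norm (\<Sum>i<k. w ^ i) \<le> norm (1 + w) + (\<Sum>i\<in>{2..<k}. \<rho> ^ i)"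
    unfolding split
    by (rule order_trans[OF norm_triangle_ineq]) (auto intro!: order_trans[OF norm_sum] simp: norm_power \<rho>_def)
  also have "\<dots> \<le> S - (\<rho> - Re w) / 2"
    using 1 unfolding S_def split by simp
  \<comment> \<open>The absolute gain becomes a relative one because S \<le> k; this is where the
    \<open>k\<close> in the exponent comes from.\<close>
  also have "\<dots> \<le> S * (1 - (\<rho> - Re w) / (2 * k))"
  proof -
    have "S \<le> (\<Sum>i<k. 1)"
      unfolding S_def using \<rho> by (intro sum_mono power_le_one) auto
    then have "S * (\<rho> - Re w) \<le> k * (\<rho> - Re w)"
      using \<rho> by (intro mult_right_mono) auto
    then show ?thesis
      using assms by (simp add: field_simps)
  qed
  also have "\<dots> \<le> S * exp (- (\<rho> - Re w) / (2 * k))"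
  proof (rule mult_left_mono)
    show "1 - (\<rho> - Re w) / (2 * k) \<le> exp (- (\<rho> - Re w) / (2 * k))"
      using exp_ge_add_one_self[of "- (\<rho> - Re w) / (2 * k)"] by (simp add: minus_divide_left[symmetric] del: minus_diff_eq)
  qed (use \<rho> in \<open>auto simp: S_def intro!: sum_nonneg\<close>)
  finally show ?thesis
    by (simp add: S_def \<rho>_def)
qed

text \<open>Apply the preceding bound to w = q^n for each paired index; the unpaired factors are
  largest at the real point \<open>norm q\<close>. Along the truncations \<open>k * M\<close> the
  exponents add up to the difference of two geometric series, at \<open>norm q\<close> and at
  \<open>q\<close>.\<close>

lemma norm_p_reg_gf_le:
  assumes q: "norm q < 1" and k: "k \<ge> 2"
  shows "norm (p_reg_gf k q) \<le> norm (p_reg_gf k (of_real (norm q))) *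
    exp (- (norm q / (1 - norm q) - Re (q / (1 - q))) / (2 * k))"
proof (rule tendsto_le)
  define \<rho> where "\<rho> = norm q"
  have \<rho>: "0 \<le> \<rho>" "\<rho> < 1" "norm (complex_of_real \<rho>) < 1"
    using q by (auto simp: \<rho>_def)
  have sub: "strict_mono (\<lambda>M. k * M)"
    using k by (auto simp: strict_mono_def)
  show "(\<lambda>M. norm (\<Prod>a\<in>regular_parts k (k * M). 1 / (1 - q ^ a))) \<longlonglongrightarrow> norm (p_reg_gf k q)"
    using LIMSEQ_subseq_LIMSEQ[OF p_reg_gf_prod_tendsto[OF q] sub]
    by (intro tendsto_norm) (simp add: o_def)
  have geo: "(\<lambda>M. \<Sum>n=1..M. w ^ n) \<longlonglongrightarrow> w / (1 - w)" if "norm w < 1" for w :: "'b :: {real_normed_field, banach}"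
  proof -
    have "(\<lambda>n. w ^ Suc n) sums (w * (1 / (1 - w)))"
      unfolding power_Suc by (intro sums_mult geometric_sums that)
    then show ?thesis
      by (simp add: sums_def sum.atLeast1_atMost_eq)
  qed
  show "(\<lambda>M. norm (\<Prod>a\<in>regular_parts k (k * M). 1 / (1 - complex_of_real (norm q) ^ a)) *
      exp (- ((\<Sum>n=1..M. norm q ^ n) - Re (\<Sum>n=1..M. q ^ n)) / (2 * k))) \<longlonglongrightarrow>
    norm (p_reg_gf k (of_real (norm q))) *
    exp (- (norm q / (1 - norm q) - Re (q / (1 - q))) / (2 * k))"
  proof (intro tendsto_mult tendsto_exp tendsto_divide tendsto_minus tendsto_diff tendsto_const tendsto_Re)
    show "(\<lambda>M. norm (\<Prod>a\<in>regular_parts k (k * M). 1 / (1 - complex_of_real (norm q) ^ a))) \<longlonglongrightarrow>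
        norm (p_reg_gf k (of_real (norm q)))"
      using LIMSEQ_subseq_LIMSEQ[OF p_reg_gf_prod_tendsto[OF \<rho>(3)] sub]
      by (intro tendsto_norm) (simp add: o_def \<rho>_def)
    show "(\<lambda>M. \<Sum>n=1..M. norm q ^ n) \<longlonglongrightarrow> norm q / (1 - norm q)" "(\<lambda>M. \<Sum>n=1..M. q ^ n) \<longlonglongrightarrow> q / (1 - q)"
      using q by (auto intro!: geo simp del: One_nat_def)
  qed (use k in auto)
  show "\<forall>\<^sub>F M in sequentially. norm (\<Prod>a\<in>regular_parts k (k * M). 1 / (1 - q ^ a)) \<le>
      norm (\<Prod>a\<in>regular_parts k (k * M). 1 / (1 - complex_of_real (norm q) ^ a)) *
      exp (- ((\<Sum>n=1..M. norm q ^ n) - Re (\<Sum>n=1..M. q ^ n)) / (2 * k))"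
  proof (intro always_eventually allI)
    fix M
    have k0: "k > 0" using k by simp
    have \<rho>n: "\<rho> ^ n < 1" if "n > 0" for n
      using \<rho> that by (simp add: power_less_one_iff)
    have "norm (\<Prod>n=1..M. \<Sum>i<k. (q ^ n) ^ i) \<le>
        (\<Prod>n=1..M. (\<Sum>i<k. (\<rho> ^ n) ^ i) * exp (- (\<rho> ^ n - Re (q ^ n)) / (2 * k)))"
      unfolding prod_norm[symmetric]
    proof (intro prod_mono conjI)
      fix n assume "n \<in> {1..M}"
      then show "norm (\<Sum>i<k. (q ^ n) ^ i) \<le> (\<Sum>i<k. (\<rho> ^ n) ^ i) * exp (- (\<rho> ^ n - Re (q ^ n)) / (2 * k))"
        using norm_geometric_sum_le[of "q ^ n" k] \<rho>n[of n] k by (simp add: norm_power \<rho>_def)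
    qed simp
    also have "\<dots> = (\<Prod>n=1..M. \<Sum>i<k. (\<rho> ^ n) ^ i) * exp (- ((\<Sum>n=1..M. \<rho> ^ n) - Re (\<Sum>n=1..M. q ^ n)) / (2 * k))"
      unfolding prod.distrib by (simp add: exp_sum[symmetric] sum_divide_distrib[symmetric] sum_negf sum_subtractf)
    finally have 1: "norm (\<Prod>n=1..M. \<Sum>i<k. (q ^ n) ^ i) \<le> \<dots>" .
    have 2: "norm (\<Prod>n\<in>{M<..k * M}. 1 / (1 - q ^ n)) \<le> (\<Prod>n\<in>{M<..k * M}. 1 / (1 - \<rho> ^ n))"
      unfolding prod_norm[symmetric]
    proof (intro prod_mono conjI)
      fix n assume "n \<in> {M<..k * M}"
      then have "\<rho> ^ n < 1" using \<rho>n by auto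
      moreover have "1 - \<rho> ^ n \<le> norm (1 - q ^ n)"
        using norm_triangle_ineq2[of 1 "q ^ n"] by (simp add: \<rho>_def norm_power)
      ultimately show "norm (1 / (1 - q ^ n)) \<le> 1 / (1 - \<rho> ^ n)"
        by (auto simp: norm_divide intro!: divide_left_mono mult_pos_pos)
    qed simp
    have 3: "norm (\<Prod>a\<in>regular_parts k (k * M). 1 / (1 - complex_of_real \<rho> ^ a)) =
        (\<Prod>a\<in>regular_parts k (k * M). 1 / (1 - \<rho> ^ a))"
    proof -
      have "(\<Prod>a\<in>regular_parts k (k * M). 1 / (1 - complex_of_real \<rho> ^ a)) =
          of_real (\<Prod>a\<in>regular_parts k (k * M). 1 / (1 - \<rho> ^ a))"
        by simp
      moreover have "(\<Prod>a\<in>regular_parts k (k * M). 1 / (1 - \<rho> ^ a)) \<ge> 0"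
        using \<rho>n by (intro prod_nonneg) (auto simp: regular_parts_def less_imp_le)
      ultimately show ?thesis
        by (simp only: norm_of_real abs_of_nonneg)
    qed
    have "norm (\<Prod>a\<in>regular_parts k (k * M). 1 / (1 - q ^ a)) \<le>
        (\<Prod>n=1..M. \<Sum>i<k. (\<rho> ^ n) ^ i) * exp (- ((\<Sum>n=1..M. \<rho> ^ n) - Re (\<Sum>n=1..M. q ^ n)) / (2 * k)) *
        (\<Prod>n\<in>{M<..k * M}. 1 / (1 - \<rho> ^ n))"
      unfolding prod_regular_parts_mult[OF q k0] norm_mult
      using \<rho>(1) by (intro mult_mono[OF 1 2]) (auto intro!: mult_nonneg_nonneg prod_nonneg sum_nonneg)
    also have "\<dots> = (\<Prod>a\<in>regular_parts k (k * M). 1 / (1 - \<rho> ^ a)) *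
        exp (- ((\<Sum>n=1..M. \<rho> ^ n) - Re (\<Sum>n=1..M. q ^ n)) / (2 * k))"
      using k \<rho> by (subst prod_regular_parts_mult) auto
    finally show "norm (\<Prod>a\<in>regular_parts k (k * M). 1 / (1 - q ^ a)) \<le>
        norm (\<Prod>a\<in>regular_parts k (k * M). 1 / (1 - complex_of_real (norm q) ^ a)) *
        exp (- ((\<Sum>n=1..M. norm q ^ n) - Re (\<Sum>n=1..M. q ^ n)) / (2 * k))"
      using 3 by (simp only: \<rho>_def)
  qed
qed simp

section \<open>Lower bound for the gap between the geometric series at \<open>norm q\<close> and at
  \<open>q\<close>\<close>

lemma one_minus_cos_ge:
  fixes y :: real
  assumes "\<bar>y\<bar> \<le> pi"
  shows "1 - cos y \<ge> 2 * y\<^sup>2 / pi\<^sup>2"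
proof -
  \<comment> \<open>Jordan's inequality, from the concavity of the sine; it is applied at the half
    angle below.\<close>
  have conc: "t * (2 / pi) \<le> sin t" if "0 \<le> t" "t \<le> pi / 2" for t :: real
  proof -
    have "concave_on {0..pi} sin"
      by (rule f''_le0_imp_concave[where f' = cos and f'' = "\<lambda>x. - sin x"])
        (auto intro!: derivative_eq_intros sin_ge_zero)
    then have "sin ((1 - 2 * t / pi) *\<^sub>R 0 + (2 * t / pi) *\<^sub>R (pi / 2)) \<ge>
        (1 - 2 * t / pi) * sin 0 + (2 * t / pi) * sin (pi / 2)"
      using that by (intro concave_onD) (auto simp: field_simps)
    then show ?thesis by (simp add: field_simps)
  qed
  define t where "t = \<bar>y\<bar> / 2"
  have "2 * y\<^sup>2 / pi\<^sup>2 = 2 * (t * (2 / pi))\<^sup>2"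
    by (simp add: t_def power_mult_distrib power_divide)
  also have "(t * (2 / pi))\<^sup>2 \<le> (sin t)\<^sup>2"
    using conc[of t] assms by (intro power_mono) (auto simp: t_def)
  also have "2 * (sin t)\<^sup>2 = 1 - cos y"
    using cos_double_sin[of t] by (simp add: t_def)
  finally show ?thesis
    by simp
qed

text \<open>With r = exp (-x), t = 1 - cos y and D = \<bar>1 - q\<bar>^2, the gap equals r (1 + r) t
  / ((1 - r) D) exactly. The bound then follows from 1 - r \<le> x and Jordan's inequality for t;
  the factor exp 1 stems from r \<ge> exp (-1), which holds as x \<le> 1.\<close>

lemma geometric_gap_ge:
  fixes x y :: real
  assumes "0 < x" "x \<le> 1" "\<bar>y\<bar> \<le> pi"
  defines "q \<equiv> exp (- Complex x y)"
  shows "norm q / (1 - norm q) - Re (q / (1 - q)) \<ge> (2 / (exp 1 * pi\<^sup>2)) * (y\<^sup>2 / (x * (x\<^sup>2 + y\<^sup>2)))"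
proof -
  define r where "r = exp (- x)"
  define t where "t = 1 - cos y"
  define D where "D = (1 - r)\<^sup>2 + 2 * r * t"
  have r: "exp (-1) \<le> r" "0 < r" "r < 1" "1 - r \<le> x"
    using assms exp_ge_add_one_self[of "-x"] by (auto simp: r_def)
  have q: "q = Complex (r * cos y) (- r * sin y)"
    by (simp add: q_def r_def exp_eq_polar complex_eq_iff Re_exp Im_exp)
  have nq: "norm q = r"
    by (simp add: q_def r_def norm_exp_eq_Re)
  have D0: "D > 0"
    unfolding D_def t_def using r by (intro add_pos_nonneg) auto
  have n2: "(norm (1 - q))\<^sup>2 = D"
  proof -
    have "(norm (1 - q))\<^sup>2 = (1 - r * cos y)\<^sup>2 + (r * sin y)\<^sup>2"
      by (simp add: cmod_power2 q)
    also have "\<dots> = 1 - 2 * r * cos y + r\<^sup>2 * ((cos y)\<^sup>2 + (sin y)\<^sup>2)"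
      by algebra
    also have "\<dots> = 1 - 2 * r * cos y + r\<^sup>2"
      by simp
    finally show ?thesis
      by (simp add: D_def t_def power2_eq_square algebra_simps)
  qed
  have "Re (q / (1 - q)) = Re (q * cnj (1 - q)) / D"
    by (simp add: complex_div_cnj[of q] n2 Re_divide_of_real flip: of_real_power)
  also have "Re (q * cnj (1 - q)) = r * cos y - r\<^sup>2 * ((cos y)\<^sup>2 + (sin y)\<^sup>2)"
  proof -
    have "Re (q * cnj (1 - q)) = r * cos y * (1 - r * cos y) - r * sin y * (r * sin y)"
      by (simp add: q)
    also have "\<dots> = r * cos y - r\<^sup>2 * ((cos y)\<^sup>2 + (sin y)\<^sup>2)"
      by algebra
    finally show ?thesis .
  qed
  finally have "Re (q / (1 - q)) = (r * cos y - r\<^sup>2) / D" by simp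
  then have "norm q / (1 - norm q) - Re (q / (1 - q)) = r / (1 - r) - (r * cos y - r\<^sup>2) / D"
    by (simp add: nq)
  also have "\<dots> = (r * D - (1 - r) * (r * cos y - r\<^sup>2)) / ((1 - r) * D)"
    using r D0 by (simp add: diff_frac_eq mult.commute)
  also have "r * D - (1 - r) * (r * cos y - r\<^sup>2) = r * (1 + r) * t"
    by (simp add: D_def t_def power2_eq_square algebra_simps)
  finally have eq: "norm q / (1 - norm q) - Re (q / (1 - q)) = r * (1 + r) * t / ((1 - r) * D)" .
  define u where "u = 2 * y\<^sup>2 / pi\<^sup>2"
  \<comment> \<open>The third inequality uses \<pi> \<ge> 2; with r < 1 it gives 2 r u \<le> y^2,
    which produces the denominator x^2 + y^2.\<close>
  have u: "0 \<le> u" "u \<le> t" "2 * u \<le> y\<^sup>2"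
    using one_minus_cos_ge[OF assms(3)] pi_ge_two power_mono[of 2 pi 2]
    by (auto simp: u_def t_def field_simps mult_right_mono)
  have "u / (x * (x\<^sup>2 + y\<^sup>2)) \<le> u / ((1 - r) * ((1 - r)\<^sup>2 + 2 * r * u))"
  proof (intro divide_left_mono mult_mono add_mono power_mono)
    show "2 * r * u \<le> y\<^sup>2"
      using u r mult_right_mono[of r 1 "2 * u"] by simp
  qed (use r u assms in \<open>auto intro!: mult_pos_pos add_pos_nonneg\<close>)
  also have "\<dots> = 1 / (1 - r) * (u / ((1 - r)\<^sup>2 + 2 * r * u))"
    by simp
  \<comment> \<open>The map s \<mapsto> s / ((1 - r)^2 + 2 r s) is increasing, so \<open>t\<close>
    may be replaced by its lower bound \<open>u\<close> although it also occurs in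
    \<open>D\<close>.\<close>
  also have "\<dots> \<le> 1 / (1 - r) * (t / D)"
  proof (rule mult_left_mono)
    have "u * D \<le> t * ((1 - r)\<^sup>2 + 2 * r * u)"
      using mult_right_mono[OF u(2), of "(1 - r)\<^sup>2"] by (simp add: D_def algebra_simps)
    moreover have "(1 - r)\<^sup>2 + 2 * r * u > 0"
      using r u by (intro add_pos_nonneg) auto
    ultimately show "u / ((1 - r)\<^sup>2 + 2 * r * u) \<le> t / D"
      using D0 by (simp add: pos_divide_le_eq pos_le_divide_eq)
  qed (use r in auto)
  finally have "exp (-1) * (u / (x * (x\<^sup>2 + y\<^sup>2))) \<le> r * (1 + r) * (1 / (1 - r) * (t / D))"
    using r u assms D0 by (intro mult_mono) (auto intro!: mult_nonneg_nonneg order_trans[OF r(1)])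
  then show ?thesis
    unfolding eq by (simp add: u_def exp_minus field_simps)
qed

section \<open>Behaviour of the generating function near the positive axis\<close>

text \<open>Near 0 this is the Bernoulli series, the sum of B_n w^(n-1) / n! over n \<ge> 1; the
  term n = 0 is the pole that has been removed. The removed poles produce the main term c /
  z.\<close>

definition bern_kernel :: "complex \<Rightarrow> complex" where
  "bern_kernel w = 1 / (exp w - 1) - 1 / w"

lemma sum_regular_parts_tendsto:
  fixes v :: complex
  assumes "norm v < 1" "k > 0"
  shows "(\<lambda>N. \<Sum>a\<in>regular_parts k N. v ^ a) \<longlonglongrightarrow> 1 / (1 - v) - 1 / (1 - v ^ k)"
proof -
  have "(\<lambda>a. v ^ a - (if k dvd a then v ^ a else 0)) sums (1 / (1 - v) - 1 / (1 - v ^ k))"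
    using assms by (intro sums_diff geometric_sums multiples_sums)
  then have "(\<lambda>N. \<Sum>a<Suc N. v ^ a - (if k dvd a then v ^ a else 0)) \<longlonglongrightarrow> 1 / (1 - v) - 1 / (1 - v ^ k)"
    unfolding sums_def by (rule LIMSEQ_Suc)
  moreover have "(\<Sum>a<Suc N. v ^ a - (if k dvd a then v ^ a else 0)) = (\<Sum>a\<in>regular_parts k N. v ^ a)" for N
    by (rule sum.mono_neutral_cong_right) (auto simp: regular_parts_def less_Suc_eq_le Suc_le_eq)
  ultimately show ?thesis by simp
qed

lemma inverse_one_minus_exp:
  assumes "exp (w :: complex) \<noteq> 1"
  shows "1 / (1 - exp (- w)) = 1 + 1 / (exp w - 1)"
  using assms by (simp add: exp_minus field_simps)

lemma exp_neq_1:
  assumes "Re w > 0"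
  shows "exp w \<noteq> 1"
  using assms norm_exp_eq_Re[of w] by (metis exp_eq_one_iff norm_one less_irrefl)

text \<open>Expand - ln (1 - q^a) for each part and exchange the sums over a and m by Tannery's
  theorem as N grows. The result is stated as an exponential, so no branch of the logarithm of the
  generating function has to be chosen.\<close>

lemma p_reg_gf_exp:
  assumes z: "Re z > 0" and k: "k > 0"
  defines "\<phi> \<equiv> \<lambda>w. 1 / (exp w - 1) - 1 / (exp (of_nat k * w) - 1)"
  shows "summable (\<lambda>m. \<phi> (of_nat (Suc m) * z) / of_nat (Suc m))"
    and "p_reg_gf k (exp (- z)) = exp (\<Sum>m. \<phi> (of_nat (Suc m) * z) / of_nat (Suc m))"
proof -
  define q where "q = exp (- z)"
  define \<rho> where "\<rho> = norm q"
  have \<rho>: "0 < \<rho>" "\<rho> < 1"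
    using z by (auto simp: \<rho>_def q_def)
  have qn: "norm (q ^ n) < 1" if "n > 0" for n
    using \<rho> that by (simp add: norm_power \<rho>_def power_less_one_iff)
  have log: "(\<lambda>m. (q ^ a) ^ Suc m / of_nat (Suc m)) sums (- ln (1 - q ^ a))" if "a > 0" for a
  proof -
    have "(\<lambda>n. - ((q ^ a) ^ n / of_nat n)) sums ln (1 - q ^ a)"
      using Ln_series'[of "- (q ^ a)"] qn[OF that] by simp
    then have "(\<lambda>n. (q ^ a) ^ n / of_nat n) sums (- ln (1 - q ^ a))"
      using sums_minus by fastforce
    then show ?thesis
      using sums_Suc_iff[of "\<lambda>n. (q ^ a) ^ n / of_nat n" "- ln (1 - q ^ a)"] by simp
  qed
  define g where "g N m = (\<Sum>a\<in>regular_parts k N. (q ^ Suc m) ^ a) / of_nat (Suc m)" for N m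
  have prod_eq: "(\<Prod>a\<in>regular_parts k N. 1 / (1 - q ^ a)) = exp (\<Sum>m. g N m)" for N
  proof -
    have "(\<Prod>a\<in>regular_parts k N. 1 / (1 - q ^ a)) = (\<Prod>a\<in>regular_parts k N. exp (- ln (1 - q ^ a)))"
    proof (rule prod.cong)
      fix a assume "a \<in> regular_parts k N"
      then have "norm (q ^ a) < 1" by (intro qn) (auto simp: regular_parts_def)
      then have "1 - q ^ a \<noteq> 0" by auto
      then show "1 / (1 - q ^ a) = exp (- ln (1 - q ^ a))"
        by (simp add: exp_minus field_simps)
    qed simp
    also have "\<dots> = exp (\<Sum>a\<in>regular_parts k N. - ln (1 - q ^ a))"
      by (simp add: exp_sum)
    also have "(\<lambda>m. \<Sum>a\<in>regular_parts k N. (q ^ a) ^ Suc m / of_nat (Suc m)) sums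
        (\<Sum>a\<in>regular_parts k N. - ln (1 - q ^ a))"
      by (intro sums_sum log) (auto simp: regular_parts_def)
    then have "(\<Sum>a\<in>regular_parts k N. - ln (1 - q ^ a)) = (\<Sum>m. g N m)"
      by (simp add: sums_iff g_def sum_divide_distrib power_mult[symmetric] mult.commute del: power_Suc of_nat_Suc)
    finally show ?thesis .
  qed
  have lim: "(\<lambda>N. g N m) \<longlonglongrightarrow> \<phi> (of_nat (Suc m) * z) / of_nat (Suc m)" for m
  proof -
    define w where "w = of_nat (Suc m) * z"
    have w: "Re w > 0" "Re (of_nat k * w) > 0"
      using z k by (auto simp: w_def simp del: of_nat_Suc)
    have v1: "q ^ Suc m = exp (- w)" and v2: "(q ^ Suc m) ^ k = exp (- (of_nat k * w))"
      by (simp_all add: q_def w_def exp_of_nat_mult[symmetric] power_mult[symmetric] del: power_Suc of_nat_Suc)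
    have "(\<lambda>N. \<Sum>a\<in>regular_parts k N. (q ^ Suc m) ^ a) \<longlonglongrightarrow>
        1 / (1 - q ^ Suc m) - 1 / (1 - (q ^ Suc m) ^ k)"
      using qn[of "Suc m"] k by (intro sum_regular_parts_tendsto) auto
    also have "1 / (1 - q ^ Suc m) - 1 / (1 - (q ^ Suc m) ^ k) = \<phi> w"
      unfolding v2 unfolding v1 inverse_one_minus_exp[OF exp_neq_1[OF w(1)]] inverse_one_minus_exp[OF exp_neq_1[OF w(2)]]
      by (simp add: \<phi>_def)
    finally show ?thesis
      unfolding g_def w_def by (intro tendsto_divide tendsto_const) (auto simp del: of_nat_Suc)
  qed
  \<comment> \<open>A majorant independent of \<open>N\<close>: the sum over all a \<ge> 1 of s^a is
    s / (1 - s) with s = \<rho>^(m+1) \<le> \<rho>.\<close>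
  have bound: "norm (g N m) \<le> \<rho> ^ Suc m / (1 - \<rho>)" for N m
  proof -
    define s where "s = \<rho> ^ Suc m"
    have s: "0 \<le> s" "s < 1" "s \<le> \<rho>"
      using \<rho> power_decreasing[of 1 "Suc m" \<rho>] by (auto simp: s_def power_less_one_iff simp del: power_Suc)
    have "norm (g N m) = norm (\<Sum>a\<in>regular_parts k N. (q ^ Suc m) ^ a) / Suc m"
      by (simp add: g_def norm_divide del: of_nat_Suc power_Suc)
    also have "\<dots> \<le> norm (\<Sum>a\<in>regular_parts k N. (q ^ Suc m) ^ a) / 1"
      by (intro divide_left_mono) auto
    also have "\<dots> \<le> (\<Sum>a\<in>regular_parts k N. s ^ a)"
      by (auto intro!: order_trans[OF norm_sum] sum_mono simp: norm_power s_def \<rho>_def norm_mult power_mult_distrib)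
    also have "\<dots> \<le> (\<Sum>a\<in>Suc ` {..<N}. s ^ a)"
      by (rule sum_mono2) (use s in \<open>auto simp: regular_parts_def image_Suc_lessThan\<close>)
    also have "\<dots> = (\<Sum>a<N. s * s ^ a)"
      by (subst sum.reindex) auto
    also have "\<dots> = s * (\<Sum>a<N. s ^ a)"
      by (simp add: sum_distrib_left)
    also have "\<dots> \<le> s * (\<Sum>a. s ^ a)"
      using s by (intro mult_left_mono sum_le_suminf) auto
    also have "\<dots> = s / (1 - s)"
      using s by (simp add: suminf_geometric)
    also have "\<dots> \<le> s / (1 - \<rho>)"
      using s \<rho> by (intro divide_left_mono) auto
    finally show ?thesis by (simp only: s_def)
  qed
  have summ: "summable (\<lambda>m. \<rho> ^ Suc m / (1 - \<rho>))"
    using \<rho> by (intro summable_divide) (simp add: summable_Suc_iff[of "\<lambda>m. \<rho> ^ m"] del: power_Suc)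
  have bound': "\<forall>\<^sub>F (m, N) in at_top \<times>\<^sub>F sequentially. norm (g N m) \<le> \<rho> ^ Suc m / (1 - \<rho>)"
    using bound by (intro always_eventually) auto
  note tan = tannerys_theorem[OF lim bound' summ sequentially_bot]
  have "summable (\<lambda>m. norm (\<phi> (of_nat (Suc m) * z) / of_nat (Suc m)))"
    using tan by blast
  then show "summable (\<lambda>m. \<phi> (of_nat (Suc m) * z) / of_nat (Suc m))"
    by (rule summable_norm_cancel)
  have "(\<lambda>N. \<Sum>m. g N m) \<longlonglongrightarrow> (\<Sum>m. \<phi> (of_nat (Suc m) * z) / of_nat (Suc m))"
    using tan by blast
  then have "(\<lambda>N. \<Prod>a\<in>regular_parts k N. 1 / (1 - q ^ a)) \<longlonglongrightarrow> exp (\<Sum>m. \<phi> (of_nat (Suc m) * z) / of_nat (Suc m))"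
    unfolding prod_eq by (rule tendsto_exp)
  moreover have "(\<lambda>N. \<Prod>a\<in>regular_parts k N. 1 / (1 - q ^ a)) \<longlonglongrightarrow> p_reg_gf k q"
    using \<rho> by (intro p_reg_gf_prod_tendsto) (simp add: \<rho>_def)
  ultimately show "p_reg_gf k (exp (- z)) = exp (\<Sum>m. \<phi> (of_nat (Suc m) * z) / of_nat (Suc m))"
    unfolding q_def using LIMSEQ_unique by blast
qed

text \<open>The expression is the derivative of \<open>bern_kernel\<close>. The proof gives order 1
  / a for small a = Re w and 1 / a^2 for large a, and a^(-5/4) covers both. Any exponent strictly
  between 1 and 3/2 would serve later: above 1 the sum over m converges, below 3/2 the error
  vanishes for y of order x^(3/2).\<close>

lemma norm_bern_kernel_deriv_le:
  assumes a: "Re w > 0" "\<bar>Im w\<bar> \<le> Re w"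
  shows "norm (1 / w\<^sup>2 - exp w / (exp w - 1)\<^sup>2) \<le> 30 * Re w powr (- 5 / 4)"
proof -
  define a where "a = Re w"
  define D where "D = exp w - 1"
  have a0: "a > 0" using assms by (simp add: a_def)
  have w: "a \<le> norm w" "norm w \<le> 2 * a" "w \<noteq> 0"
    using assms complex_Re_le_cmod[of w] cmod_le[of w] by (auto simp: a_def)
  have Da: "exp a - 1 \<le> norm D"
    using norm_triangle_ineq2[of "exp w" 1] by (simp add: D_def a_def)
  then have Da': "a \<le> norm D"
    using exp_ge_add_one_self[of a] by linarith
  then have D0: "D \<noteq> 0" using a0 by auto
  show ?thesis
  proof (cases "norm w \<le> 1")
    case True
    have e3: "exp \<bar>Re w\<bar> \<le> 3"
      using True w(1) a0 exp_le by (smt (verit) a_def exp_less_mono)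
    have "norm (D - w) \<le> exp \<bar>Re w\<bar> * norm w ^ 2"
      using Taylor_exp[of w 1] by (simp add: D_def algebra_simps power2_eq_square)
    also have "\<dots> \<le> 3 * norm w ^ 2"
      using e3 by (intro mult_right_mono) auto
    finally have 1: "norm (D - w) \<le> 3 * norm w ^ 2" .
    have "norm D \<le> exp \<bar>Re w\<bar> * norm w"
      using Taylor_exp[of w 0] by (simp add: D_def)
    also have "\<dots> \<le> 3 * norm w"
      using e3 by (intro mult_right_mono) auto
    finally have 2: "norm D \<le> 3 * norm w" .
    \<comment> \<open>A rearrangement using exp w = D + 1 that makes both terms visibly of third
      order in w.\<close>
    have "D\<^sup>2 - w\<^sup>2 * exp w = (D - w) * (D + w) - w\<^sup>2 * D"
      by (simp add: D_def power2_eq_square algebra_simps)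
    also have "norm \<dots> \<le> norm (D - w) * norm (D + w) + norm w ^ 2 * norm D"
      by (rule order_trans[OF norm_triangle_ineq4]) (simp add: norm_mult norm_power)
    also have "\<dots> \<le> (3 * norm w ^ 2) * (4 * norm w) + norm w ^ 2 * (3 * norm w)"
      using norm_triangle_ineq[of D w] 1 2 by (intro add_mono mult_mono) auto
    also have "\<dots> = 15 * norm w * (norm w)\<^sup>2"
      by (simp add: power2_eq_square)
    finally have 3: "norm (D\<^sup>2 - w\<^sup>2 * exp w) \<le> 15 * norm w * (norm w)\<^sup>2" .
    have "norm (1 / w\<^sup>2 - exp w / D\<^sup>2) = norm (D\<^sup>2 - w\<^sup>2 * exp w) / ((norm w)\<^sup>2 * (norm D)\<^sup>2)"
      using w D0 by (simp add: diff_frac_eq norm_divide norm_mult norm_power mult.commute)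
    also have "\<dots> \<le> (15 * norm w * (norm w)\<^sup>2) / ((norm w)\<^sup>2 * (norm D)\<^sup>2)"
      by (intro divide_right_mono 3) auto
    also have "\<dots> = 15 * norm w / (norm D)\<^sup>2"
      using w by simp
    also have "\<dots> \<le> 15 * (2 * a) / a\<^sup>2"
      using w Da' a0 D0 by (intro frac_le mult_left_mono power_mono) auto
    also have "\<dots> = 30 * a powr (-1)"
      using a0 by (simp add: power2_eq_square powr_minus field_simps)
    also have "\<dots> \<le> 30 * a powr (- 5 / 4)"
      using True w a0 by (intro mult_left_mono powr_mono') auto
    finally show ?thesis by (simp add: D_def a_def)
  next
    case False
    then have a2: "a \<ge> 1 / 2" using w by linarith
    have "norm (exp w / D\<^sup>2) = exp a / (norm D)\<^sup>2"
      by (simp add: norm_divide norm_power a_def)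
    also have "\<dots> \<le> exp a / (exp a - 1)\<^sup>2"
      using Da a0 D0 by (intro divide_left_mono power_mono) auto
    \<comment> \<open>One factor exp a - 1 absorbs exp a, because a \<ge> 1/2 keeps it away from 0;
      the other is at least a^2 / 2.\<close>
    also have "\<dots> \<le> 6 / a\<^sup>2"
    proof -
      have e: "exp a \<ge> 1 + a + a\<^sup>2 / 2"
        using exp_lower_Taylor_quadratic[of a] a0 by simp
      have "1 + 1 / 2 \<le> exp a"
        using add_left_mono[OF a2, of 1] exp_ge_add_one_self[of a] by (rule order_trans)
      then have "exp a \<le> 3 * (exp a - 1)"
        by simp
      then have "exp a * a\<^sup>2 \<le> 3 * (exp a - 1) * (2 * (exp a - 1))"
        using e a0 by (intro mult_mono) auto
      also have "\<dots> = 6 * (exp a - 1)\<^sup>2"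
        by algebra
      finally show ?thesis
        using a0 by (intro mult_imp_div_pos_le) (simp_all add: pos_le_divide_eq)
    qed
    finally have 1: "norm (exp w / D\<^sup>2) \<le> 6 / a\<^sup>2" .
    have 2: "norm (1 / w\<^sup>2) \<le> 1 / a\<^sup>2"
      using w a0 by (auto simp: norm_divide norm_power intro!: divide_left_mono power_mono)
    have "a powr (-3/4) \<le> (1/2) powr (-3/4)"
      using a2 a0 by (intro powr_mono2') auto
    also have "(1/2::real) powr (-3/4) \<le> (1/2) powr (-1)"
      by (intro powr_mono') auto
    also have "(1/2::real) powr (-1) = 2"
      by (simp add: powr_minus)
    finally have 3: "a powr (-3/4) \<le> 2" .
    have "norm (1 / w\<^sup>2 - exp w / D\<^sup>2) \<le> 1 / a\<^sup>2 + 6 / a\<^sup>2"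
      using norm_triangle_ineq4[of "1 / w\<^sup>2" "exp w / D\<^sup>2"] 1 2 by linarith
    also have "\<dots> = 7 * a powr (-2)"
      using a0 by (simp add: powr_minus powr_numeral field_simps)
    also have "a powr (-2) = a powr (-5/4) * a powr (-3/4)"
      by (simp flip: powr_add)
    also have "7 * (a powr (-5/4) * a powr (-3/4)) \<le> 7 * (a powr (-5/4) * 2)"
      using 3 by (intro mult_left_mono) auto
    also have "\<dots> \<le> 30 * a powr (-5/4)"
      using powr_ge_zero[of a "-5/4"] by linarith
    finally show ?thesis by (simp add: D_def a_def)
  qed
qed

text \<open>Mean value estimate along the vertical segment from x: the real part stays x, so the
  derivative bound is the same at every point.\<close>

lemma norm_bern_kernel_diff_le:
  assumes "x > 0" "\<bar>y\<bar> \<le> x"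
  shows "norm (bern_kernel (Complex x y) - bern_kernel (of_real x)) \<le> 30 * x powr (- 5 / 4) * \<bar>y\<bar>"
proof -
  let ?S = "closed_segment (of_real x) (Complex x y)"
  have S: "Re w = x" "\<bar>Im w\<bar> \<le> x" if "w \<in> ?S" for w
  proof -
    obtain u where u: "0 \<le> u" "u \<le> 1" "w = (1 - u) *\<^sub>R of_real x + u *\<^sub>R Complex x y"
      using \<open>w \<in> ?S\<close> by (auto simp: in_segment)
    show "Re w = x"
      unfolding u(3) by (simp add: algebra_simps)
    show "\<bar>Im w\<bar> \<le> x"
      unfolding u(3) using u(1,2) mult_mono[of u 1 "\<bar>y\<bar>" x] assms by (simp add: abs_mult)
  qed
  have "norm (bern_kernel (Complex x y) - bern_kernel (of_real x)) \<le>
      30 * x powr (- 5 / 4) * norm (Complex x y - of_real x)"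
  proof (rule field_differentiable_bound[where S = ?S and f' = "\<lambda>w. 1 / w\<^sup>2 - exp w / (exp w - 1)\<^sup>2"])
    fix w assume "w \<in> ?S"
    then have w: "Re w = x" "\<bar>Im w\<bar> \<le> x" by (auto dest: S)
    then have "exp w - 1 \<noteq> 0" "w \<noteq> 0"
      using assms exp_neq_1[of w] by auto
    then show "(bern_kernel has_field_derivative 1 / w\<^sup>2 - exp w / (exp w - 1)\<^sup>2) (at w within ?S)"
      unfolding bern_kernel_def[abs_def]
      by (auto intro!: derivative_eq_intros simp: power2_eq_square)
    show "norm (1 / w\<^sup>2 - exp w / (exp w - 1)\<^sup>2) \<le> 30 * x powr (- 5 / 4)"
      using norm_bern_kernel_deriv_le[of w] w assms by simp
  qed auto
  also have "Complex x y - of_real x = \<i> * of_real y"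
    by (simp add: complex_eq_iff)
  finally show ?thesis by (simp add: norm_mult)
qed

text \<open>In the series for the logarithm, the poles 1 / (m z) - 1 / (k m z), weighted by 1 / m,
  sum to 4 \<pi>^2 m_k / z. Comparing with the point x on the axis leaves only differences of
  \<open>bern_kernel\<close>, so neither the constant nor the logarithmic term of the full expansion
  has to be found.\<close>

lemma p_reg_gf_near_axis:
  assumes k: "k \<ge> 2"
  obtains K where "\<And>x y. x > 0 \<Longrightarrow> \<bar>y\<bar> \<le> x \<Longrightarrow>
    \<exists>R. norm R \<le> K * (\<bar>y\<bar> * x powr (- 5 / 4)) \<and>
      p_reg_gf k (exp (- Complex x y)) = p_reg_gf k (exp (- of_real x)) *
        exp (of_real (4 * pi\<^sup>2 * m_reg k) * (1 / Complex x y - 1 / of_real x) + R)"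
proof -
  define S where "S = (\<Sum>m. real (Suc m) powr (- 5 / 4))"
  define K where "K = 60 * S"
  have summ: "summable (\<lambda>m. real (Suc m) powr (- 5 / 4))"
    by (subst summable_Suc_iff) (simp add: summable_real_powr_iff)
  define f where "f z = (\<Sum>m. (1 / (exp (of_nat (Suc m) * z) - 1) - 1 / (exp (of_nat k * (of_nat (Suc m) * z)) - 1)) / of_nat (Suc m))"
    for z :: complex
  define C where "C = (1 - 1 / of_nat k :: complex)"
  have Csum: "(\<lambda>m. C / z * (1 / of_nat (Suc m) ^ 2)) sums (of_real (4 * pi\<^sup>2 * m_reg k) / z)" for z
  proof -
    have "(\<lambda>m. of_real (1 / (real m + 1)\<^sup>2) :: complex) sums of_real (pi\<^sup>2 / 6)"
      using inverse_squares_sums by (subst sums_of_real_iff) (simp add: add.commute)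
    then have "(\<lambda>m. C / z * of_real (1 / (real m + 1)\<^sup>2)) sums (C / z * of_real (pi\<^sup>2 / 6))"
      by (rule sums_mult)
    \<comment> \<open>The right side is (1 - 1/k) \<zeta>(2), and m_k = (1 - 1/k) / 24.\<close>
    moreover have "4 * pi\<^sup>2 * m_reg k = (1 - 1 / real k) * (pi\<^sup>2 / 6)"
      using k by (simp add: m_reg_def field_simps)
    then have "C / z * of_real (pi\<^sup>2 / 6) = of_real (4 * pi\<^sup>2 * m_reg k) / z"
      by (simp only: of_real_mult) (simp add: C_def)
    ultimately show ?thesis
      by (simp add: add.commute)
  qed
  have fsum: "(\<lambda>m. (bern_kernel (of_nat (Suc m) * z) - bern_kernel (of_nat k * (of_nat (Suc m) * z))) / of_nat (Suc m))
      sums (f z - of_real (4 * pi\<^sup>2 * m_reg k) / z)"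
    and Pf: "p_reg_gf k (exp (- z)) = exp (f z)"
    if z: "Re z > 0" for z
  proof -
    have "(\<lambda>m. (1 / (exp (of_nat (Suc m) * z) - 1) - 1 / (exp (of_nat k * (of_nat (Suc m) * z)) - 1)) / of_nat (Suc m)) sums f z"
      using p_reg_gf_exp(1)[OF z, of k] k unfolding f_def by (intro summable_sums) simp
    from sums_diff[OF this Csum[of z]]
    show "(\<lambda>m. (bern_kernel (of_nat (Suc m) * z) - bern_kernel (of_nat k * (of_nat (Suc m) * z))) / of_nat (Suc m))
      sums (f z - of_real (4 * pi\<^sup>2 * m_reg k) / z)"
    proof (rule sums_cong[THEN iffD1, rotated])
      fix m
      define u where "u = (of_nat (Suc m) :: complex)"
      have "z \<noteq> 0" "u \<noteq> 0" "of_nat k \<noteq> (0 :: complex)"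
        using z k by (auto simp: u_def simp del: of_nat_Suc)
      then have "C / z * (1 / u\<^sup>2) = (1 / (u * z) - 1 / (of_nat k * (u * z))) / u"
        by (simp add: C_def field_simps power2_eq_square)
      then show "(1 / (exp (of_nat (Suc m) * z) - 1) - 1 / (exp (of_nat k * (of_nat (Suc m) * z)) - 1)) / of_nat (Suc m) -
          C / z * (1 / of_nat (Suc m) ^ 2) =
        (bern_kernel (of_nat (Suc m) * z) - bern_kernel (of_nat k * (of_nat (Suc m) * z))) / of_nat (Suc m)"
        unfolding u_def[symmetric] by (simp add: bern_kernel_def diff_divide_distrib)
    qed
    show "p_reg_gf k (exp (- z)) = exp (f z)"
      using p_reg_gf_exp(2)[OF z, of k] k unfolding f_def by simp
  qed
  show ?thesis
  proof (rule that[of K])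
    fix x y :: real
    assume x: "x > 0" and y: "\<bar>y\<bar> \<le> x"
    define z where "z = Complex x y"
    have z: "Re z > 0" "Re (complex_of_real x) > 0" using x by (auto simp: z_def)
    let ?c = "of_real (4 * pi\<^sup>2 * m_reg k) :: complex"
    let ?B = "\<lambda>z m. (bern_kernel (of_nat (Suc m) * z) - bern_kernel (of_nat k * (of_nat (Suc m) * z))) / of_nat (Suc m)"
    define R where "R = (f z - ?c / z) - (f (of_real x) - ?c / of_real x)"
    have Rsums: "(\<lambda>m. ?B z m - ?B (of_real x) m) sums R"
      unfolding R_def by (intro sums_diff fsum z)
    \<comment> \<open>Dilation by j scales the derivative bound by j^(-5/4) and the length of the
      segment by j. The weight 1 / m of the series then restores the summable exponent -5/4.\<close>
    have dil: "norm (bern_kernel (of_nat j * z) - bern_kernel (of_nat j * of_real x)) \<le>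
        30 * (\<bar>y\<bar> * x powr (- 5 / 4)) * real j powr (- 1 / 4)" if "j > 0" for j
    proof -
      have "real j * \<bar>y\<bar> \<le> real j * x" using y by (intro mult_left_mono) auto
      then have "norm (bern_kernel (Complex (real j * x) (real j * y)) - bern_kernel (of_real (real j * x)))
          \<le> 30 * (real j * x) powr (- 5 / 4) * \<bar>real j * y\<bar>"
        using x that by (intro norm_bern_kernel_diff_le) (auto simp: abs_mult)
      also have "Complex (real j * x) (real j * y) = of_nat j * z"
        by (simp add: complex_eq_iff z_def)
      also have "30 * (real j * x) powr (- 5 / 4) * \<bar>real j * y\<bar> =
          30 * (\<bar>y\<bar> * x powr (- 5 / 4)) * (real j powr (- 5 / 4) * real j powr 1)"
        using x that by (simp add: powr_mult abs_mult)
      also have "real j powr (- 5 / 4) * real j powr 1 = real j powr (- 1 / 4)"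
        by (subst powr_add[symmetric]) simp
      finally show ?thesis by simp
    qed
    have term_le: "norm (?B z m - ?B (of_real x) m) \<le> 60 * (\<bar>y\<bar> * x powr (- 5 / 4)) * real (Suc m) powr (- 5 / 4)" for m
    proof -
      define j where "j = Suc m"
      let ?Y = "30 * (\<bar>y\<bar> * x powr (- 5 / 4))"
      have j: "j > 0" "k * j > 0" using k by (auto simp: j_def)
      have "?B z m - ?B (of_real x) m =
        ((bern_kernel (of_nat j * z) - bern_kernel (of_nat j * of_real x)) -
         (bern_kernel (of_nat (k * j) * z) - bern_kernel (of_nat (k * j) * of_real x))) / of_nat j"
        unfolding j_def[symmetric] by (simp add: diff_divide_distrib mult.assoc)
      also have "norm \<dots> \<le> (?Y * real j powr (- 1 / 4) + ?Y * real (k * j) powr (- 1 / 4)) / real j"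
        unfolding norm_divide norm_of_nat
        by (intro divide_right_mono order_trans[OF norm_triangle_ineq4] add_mono dil j) auto
      also have "\<dots> \<le> (?Y * real j powr (- 1 / 4) + ?Y * real j powr (- 1 / 4)) / real j"
      proof (intro divide_right_mono add_left_mono mult_left_mono powr_mono2')
        show "real j \<le> real (k * j)" unfolding of_nat_le_iff using k by simp
      qed (use j in auto)
      also have "\<dots> = 60 * (\<bar>y\<bar> * x powr (- 5 / 4)) * (real j powr (- 1 / 4) / real j powr 1)"
        using j by simp
      also have "real j powr (- 1 / 4) / real j powr 1 = real j powr (- 5 / 4)"
        by (subst powr_diff[symmetric]) simp
      finally show ?thesis by (simp only: j_def)
    qed
    have "norm R \<le> (\<Sum>m. 60 * (\<bar>y\<bar> * x powr (- 5 / 4)) * real (Suc m) powr (- 5 / 4))"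
      using Rsums norm_suminf_le[OF term_le summable_mult[OF summ]] by (simp add: sums_iff)
    also have "\<dots> = K * (\<bar>y\<bar> * x powr (- 5 / 4))"
      using summ by (subst suminf_mult) (auto simp: K_def S_def)
    finally have "norm R \<le> K * (\<bar>y\<bar> * x powr (- 5 / 4))" .
    moreover have "p_reg_gf k (exp (- z)) = p_reg_gf k (exp (- of_real x)) * exp (?c * (1 / z - 1 / of_real x) + R)"
      unfolding Pf[OF z(1)] Pf[OF z(2)] exp_add[symmetric] by (simp add: R_def algebra_simps)
    ultimately show "\<exists>R. norm R \<le> K * (\<bar>y\<bar> * x powr (- 5 / 4)) \<and>
      p_reg_gf k (exp (- Complex x y)) = p_reg_gf k (exp (- of_real x)) *
        exp (of_real (4 * pi\<^sup>2 * m_reg k) * (1 / Complex x y - 1 / of_real x) + R)"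
      unfolding z_def by blast
  qed
qed

section \<open>The renormalized Jensen polynomials as contour integrals\<close>

lemma integral_exp_int_period:
  fixes j :: int
  shows "has_bochner_integral lborel (\<lambda>y. indicator {-pi..pi} y *\<^sub>R exp (\<i> * of_int j * of_real y))
    (if j = 0 then of_real (2 * pi) else 0)"
proof (cases "j = 0")
  case True
  have "has_bochner_integral lborel (\<lambda>y. indicator {-pi..pi} y *\<^sub>R (1 :: complex)) (of_real pi - of_real (- pi))"
    by (rule has_bochner_integral_FTC_Icc[where F = "\<lambda>y. of_real y"])
      (auto intro!: derivative_eq_intros)
  then show ?thesis using True by simp
next
  case False
  have "has_bochner_integral lborel (\<lambda>y. indicator {-pi..pi} y *\<^sub>R exp (\<i> * of_int j * of_real y))
    (exp (\<i> * of_int j * of_real pi) / (\<i> * of_int j) - exp (\<i> * of_int j * of_real (- pi)) / (\<i> * of_int j))"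
  proof (rule has_bochner_integral_FTC_Icc[where F = "\<lambda>y. exp (\<i> * of_int j * of_real y) / (\<i> * of_int j)"])
    fix y :: real
    have "((\<lambda>z. exp (\<i> * of_int j * z) / (\<i> * of_int j)) has_field_derivative exp (\<i> * of_int j * of_real y)) (at (of_real y))"
      using False by (auto intro!: derivative_eq_intros)
    then show "((\<lambda>y. exp (\<i> * of_int j * of_real y) / (\<i> * of_int j)) has_vector_derivative
        exp (\<i> * of_int j * of_real y)) (at y within {- pi..pi})"
      by (rule has_vector_derivative_real_field)
  qed (auto intro!: continuous_intros)
  moreover have "exp (\<i> * of_int j * of_real pi) = exp (\<i> * of_int j * of_real (- pi))"
    by (subst exp_eq) (auto intro!: exI[of _ j] simp: algebra_simps)
  ultimately show ?thesis using False by simp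
qed

lemma continuous_on_p_reg_gf:
  assumes "x > 0"
  shows "continuous_on S (\<lambda>y. p_reg_gf k (exp (- Complex x y)))"
proof (rule continuous_on_compose2[of "ball 0 1" "p_reg_gf k"])
  show "continuous_on (ball 0 1) (p_reg_gf k)"
  proof (intro continuous_at_imp_continuous_on ballI)
    fix q :: complex assume "q \<in> ball 0 1"
    then obtain r where r: "norm q < r" "r < 1" using dense by auto
    then have r0: "r > 0" using norm_ge_zero[of q] by linarith
    show "isCont (p_reg_gf k) q"
      unfolding p_reg_gf_def[abs_def]
      by (rule isCont_powser[where K = "of_real r"])
        (use r r0 p_reg_gf_sums[of "of_real r" k] in \<open>auto simp: sums_iff\<close>)
  qed
  show "continuous_on S (\<lambda>y. exp (- Complex x y))"
    unfolding Complex_eq by (intro continuous_intros)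
  show "(\<lambda>y. exp (- Complex x y)) ` S \<subseteq> ball 0 1"
    using assms by auto
qed

lemma p_reg_fourier:
  assumes x: "x > 0"
  shows "has_bochner_integral lborel
    (\<lambda>y. indicator {-pi..pi} y *\<^sub>R (p_reg_gf k (exp (- Complex x y)) * exp (of_nat N * Complex x y)))
    (of_real (2 * pi) * of_nat (p_reg k N))"
proof -
  define f where "f n y = indicator {-pi..pi} y *\<^sub>R
    (of_nat (p_reg k n) * exp (- of_nat n * Complex x y) * exp (of_nat N * Complex x y))" for n y
  have f_eq: "f n y = (of_nat (p_reg k n) * exp (of_real ((real N - real n) * x))) *
      (indicator {-pi..pi} y *\<^sub>R exp (\<i> * of_int (int N - int n) * of_real y))" for n y
    by (auto simp: f_def Complex_eq exp_add[symmetric] exp_diff[symmetric] algebra_simps split: split_indicator)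
  have f_int: "has_bochner_integral lborel (f n) (if n = N then of_real (2 * pi) * of_nat (p_reg k N) else 0)" for n
  proof -
    have "has_bochner_integral lborel (f n) ((of_nat (p_reg k n) * exp (of_real ((real N - real n) * x))) *
        (if int N - int n = 0 then of_real (2 * pi) else 0))"
      unfolding f_eq by (intro has_bochner_integral_mult_right integral_exp_int_period)
    then show ?thesis by (auto simp: mult_ac split: if_splits)
  qed
  \<comment> \<open>The modulus depends on y only through the indicator, so one convergent series
    justifies the exchange of sum and integral.\<close>
  have norm_f: "norm (f n y) = indicator {-pi..pi} y * (exp (N * x) * (real (p_reg k n) * exp (- x) ^ n))" for n y
    by (auto simp: f_def norm_mult exp_of_nat_mult[symmetric] split: split_indicator)
  have summ: "summable (\<lambda>n. exp (N * x) * (real (p_reg k n) * exp (- x) ^ n))"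
    using x by (intro summable_mult summable_p_reg) auto
  have sumf: "(\<Sum>n. f n y) = indicator {-pi..pi} y *\<^sub>R (p_reg_gf k (exp (- Complex x y)) * exp (of_nat N * Complex x y))" for y
  proof -
    have "(\<lambda>n. of_nat (p_reg k n) * exp (- Complex x y) ^ n) sums p_reg_gf k (exp (- Complex x y))"
      using x by (intro p_reg_gf_sums) simp
    then have "(\<lambda>n. indicator {-pi..pi} y *\<^sub>R (of_nat (p_reg k n) * exp (- Complex x y) ^ n * exp (of_nat N * Complex x y)))
        sums (indicator {-pi..pi} y *\<^sub>R (p_reg_gf k (exp (- Complex x y)) * exp (of_nat N * Complex x y)))"
      by (intro sums_scaleR_right sums_mult2)
    then show ?thesis by (simp add: f_def[abs_def] sums_iff exp_of_nat_mult[symmetric])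
  qed
  have int: "integrable lborel (f n)" for n
    by (rule integrable.intros[OF f_int])
  have AE: "AE y in lborel. summable (\<lambda>n. norm (f n y))"
    unfolding norm_f by (intro always_eventually allI summable_mult summ)
  have "summable (\<lambda>n. \<integral>y. norm (f n y) \<partial>lborel)"
    unfolding norm_f using summ by (simp add: summable_mult)
  note I = integral_suminf[OF int AE this] integrable_suminf[OF int AE this]
  have "(\<integral>y. (\<Sum>n. f n y) \<partial>lborel) = (\<Sum>n. if n = N then of_real (2 * pi) * of_nat (p_reg k N) else 0)"
    unfolding I(1) has_bochner_integral_integral_eq[OF f_int] ..
  also have "\<dots> = of_real (2 * pi) * of_nat (p_reg k N)"
    using sums_single[of N "\<lambda>_. of_real (2 * pi) * of_nat (p_reg k N) :: complex"] by (simp add: sums_iff)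
  finally show ?thesis
    using I(2) unfolding sumf[symmetric] by (simp add: has_bochner_integral_iff)
qed

text \<open>With e = exp (z - A), the powers come from the binomial expansion of (X e + (1 - e) /
  \<delta>)^d: \<open>j\<close> counts the factors X e, and \<open>l\<close> the others. The
  exponents are kept independent so that l = j = 0 yields the denominator, the integral for
  \<open>p_reg k n\<close>.\<close>

definition jensen_integrand :: "nat \<Rightarrow> nat \<Rightarrow> real \<Rightarrow> real \<Rightarrow> real \<Rightarrow> nat \<Rightarrow> nat \<Rightarrow> real \<Rightarrow> complex" where
  "jensen_integrand k n x A \<delta> l j y = indicator {-pi..pi} y *\<^sub>R
     (p_reg_gf k (exp (- Complex x y)) * exp (of_nat n * Complex x y) *
      exp (Complex x y - of_real A) ^ j * ((1 - exp (Complex x y - of_real A)) / of_real \<delta>) ^ l)"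

lemma integrable_jensen_integrand:
  assumes "x > 0"
  shows "integrable lborel (jensen_integrand k n x A \<delta> l j)"
proof -
  have "set_integrable lborel {-pi..pi} (\<lambda>y. p_reg_gf k (exp (- Complex x y)) * exp (of_nat n * Complex x y) *
      exp (Complex x y - of_real A) ^ j * ((1 - exp (Complex x y - of_real A)) / of_real \<delta>) ^ l)"
    unfolding Complex_eq divide_inverse
    by (intro borel_integrable_atLeastAtMost' continuous_intros
        continuous_on_p_reg_gf[OF assms, unfolded Complex_eq])
  then show ?thesis
    by (simp add: set_integrable_def jensen_integrand_def[abs_def])
qed

lemma p_reg_jensen_integrand:
  assumes "x > 0"
  shows "(\<integral>y. jensen_integrand k n x A \<delta> 0 0 y \<partial>lborel) = of_real (2 * pi) * of_nat (p_reg k n)"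
  using p_reg_fourier[OF assms, of k n]
  by (simp add: jensen_integrand_def[abs_def] has_bochner_integral_integral_eq)

text \<open>Inserting the integral for every p_k(n + i) turns the Jensen polynomial at v into the
  integral of (1 + v exp z)^d, since the shift by i only contributes exp (i z). The point
  \<open>x\<close> is still free here.\<close>

lemma poly_renorm_jensen_poly_eq:
  assumes "x > 0" "delta_reg k n \<noteq> 0"
  shows "complex_of_real (poly (renorm_jensen_poly k d n) X) =
    (\<Sum>j\<le>d. of_nat (d choose j) * of_real X ^ j *
      ((\<integral>y. jensen_integrand k n x (A_reg k d n) (delta_reg k n) (d - j) j y \<partial>lborel) /
       (\<integral>y. jensen_integrand k n x (A_reg k d n) (delta_reg k n) 0 0 y \<partial>lborel)))"
proof -
  define A where "A = A_reg k d n"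
  define \<delta> where "\<delta> = delta_reg k n"
  define v where "v = (complex_of_real \<delta> * of_real X - 1) / exp (of_real A)"
  define F where "F = (\<lambda>N y. indicator {-pi..pi} y *\<^sub>R (p_reg_gf k (exp (- Complex x y)) * exp (of_nat N * Complex x y)))"
  have \<delta>: "\<delta> \<noteq> 0" using assms by (simp add: \<delta>_def)
  have F: "integrable lborel (F N)" "(\<integral>y. F N y \<partial>lborel) = of_real (2 * pi) * of_nat (p_reg k N)" for N
    using p_reg_fourier[OF assms(1), of k N] by (simp_all add: F_def has_bochner_integral_iff)
  have "complex_of_real (poly (renorm_jensen_poly k d n) X) =
      1 / (of_real \<delta> ^ d * of_nat (p_reg k n)) * (\<Sum>i\<le>d. of_nat (d choose i) * of_nat (p_reg k (n + i)) * v ^ i)"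
    by (simp add: renorm_jensen_poly_def jensen_poly_def poly_pcompose poly_sum poly_monom v_def \<delta>_def A_def
        power_int_minus field_simps exp_of_real flip: exp_of_real)
  also have "(\<Sum>i\<le>d. of_nat (d choose i) * of_nat (p_reg k (n + i)) * v ^ i) =
      (\<Sum>i\<le>d. of_nat (d choose i) * v ^ i * (\<integral>y. F (n + i) y \<partial>lborel)) / of_real (2 * pi)"
    by (simp add: F sum_distrib_left sum_divide_distrib mult_ac)
  also have "(\<Sum>i\<le>d. of_nat (d choose i) * v ^ i * (\<integral>y. F (n + i) y \<partial>lborel)) =
      (\<integral>y. (\<Sum>i\<le>d. of_nat (d choose i) * v ^ i * F (n + i) y) \<partial>lborel)"
    using F(1) by (subst Bochner_Integration.integral_sum) auto
  also have "(\<lambda>y. \<Sum>i\<le>d. of_nat (d choose i) * v ^ i * F (n + i) y) =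
      (\<lambda>y. \<Sum>j\<le>d. of_nat (d choose j) * of_real X ^ j * of_real \<delta> ^ d * jensen_integrand k n x A \<delta> (d - j) j y)"
  proof
    fix y
    define z where "z = Complex x y"
    define e where "e = exp (z - of_real A)"
    define G where "G = indicator {-pi..pi} y *\<^sub>R (p_reg_gf k (exp (- z)) * exp (of_nat n * z))"
    have ve: "v * exp z = (of_real \<delta> * of_real X - 1) * e"
      by (simp add: v_def e_def exp_diff)
    have e_add: "exp (of_nat (n + i) * z) = exp (of_nat n * z) * exp z ^ i" for i
      by (simp add: distrib_right exp_add exp_of_nat_mult)
    have "(\<Sum>i\<le>d. of_nat (d choose i) * v ^ i * F (n + i) y) =
        G * (\<Sum>i\<le>d. of_nat (d choose i) * (v * exp z) ^ i * 1 ^ (d - i))"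
      unfolding F_def G_def z_def[symmetric] e_add sum_distrib_left
      by (intro sum.cong) (auto simp: power_mult_distrib split: split_indicator)
    also have "\<dots> = G * (v * exp z + 1) ^ d"
      by (simp add: binomial_ring)
    \<comment> \<open>Extracting \<delta> here cancels the factor \<delta>^(-d) of the
      renormalization and leaves a base that has a limit at the scale y = 2 \<delta> u.\<close>
    also have "v * exp z + 1 = of_real \<delta> * (of_real X * e + (1 - e) / of_real \<delta>)"
      unfolding ve using \<delta> by (simp add: field_simps)
    also have "G * (of_real \<delta> * (of_real X * e + (1 - e) / of_real \<delta>)) ^ d =
        G * of_real \<delta> ^ d * (\<Sum>j\<le>d. of_nat (d choose j) * (of_real X * e) ^ j * ((1 - e) / of_real \<delta>) ^ (d - j))"
      unfolding power_mult_distrib[of "of_real \<delta>"] by (simp add: binomial_ring)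
    also have "\<dots> = (\<Sum>j\<le>d. of_nat (d choose j) * of_real X ^ j * of_real \<delta> ^ d * jensen_integrand k n x A \<delta> (d - j) j y)"
      unfolding jensen_integrand_def z_def[symmetric] e_def[symmetric] sum_distrib_left G_def
      by (auto simp: power_mult_distrib mult_ac intro!: sum.cong split: split_indicator)
    finally show "(\<Sum>i\<le>d. of_nat (d choose i) * v ^ i * F (n + i) y) = \<dots>" .
  qed
  also have "(\<integral>y. (\<Sum>j\<le>d. of_nat (d choose j) * of_real X ^ j * of_real \<delta> ^ d * jensen_integrand k n x A \<delta> (d - j) j y) \<partial>lborel) =
      (\<Sum>j\<le>d. of_nat (d choose j) * of_real X ^ j * of_real \<delta> ^ d * (\<integral>y. jensen_integrand k n x A \<delta> (d - j) j y \<partial>lborel))"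
    using integrable_jensen_integrand[OF assms(1)] by (subst Bochner_Integration.integral_sum) auto
  finally show ?thesis
    unfolding p_reg_jensen_integrand[OF assms(1)] using \<delta>
    by (simp add: A_def[symmetric] \<delta>_def[symmetric] sum_distrib_left sum_divide_distrib field_simps)
qed

section \<open>Asymptotics of the normalizing constants\<close>

text \<open>The series is the tail from index 2 of the binomial series of sqrt (1 + w) at w = 1 / n.
  The assumption n \<ge> 2 puts w strictly inside the disc of convergence.\<close>

lemma delta_reg_eq:
  assumes "n \<ge> 2"
  shows "delta_reg k n = sqrt (4 * pi * sqrt (m_reg k) * (sqrt n * (1 + 1 / (2 * real n) - sqrt (1 + 1 / n))))"
proof -
  define w where "w = 1 / real n"
  have w: "0 < w" "\<bar>w\<bar> < 1" "n > 0" using assms by (auto simp: w_def)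
  have "(\<lambda>i. ((1 / 2) gchoose i) * w ^ i) sums (1 + w) powr (1 / 2)"
    using w by (intro gen_binomial_real) auto
  then have "(\<lambda>i. ((1 / 2) gchoose (i + 2)) * w ^ (i + 2)) sums ((1 + w) powr (1 / 2) -
      (\<Sum>i<2. ((1 / 2) gchoose i) * w ^ i))"
    by (rule sums_split_initial_segment)
  then have "(\<lambda>i. ((1 / 2) gchoose (i + 2)) * w ^ (i + 2)) sums (sqrt (1 + w) - 1 - w / 2)"
    using w by (simp add: numeral_2_eq_2 powr_half_sqrt algebra_simps)
  then have "(\<lambda>i. 4 * pi * sqrt (m_reg k) * sqrt n * (((1 / 2) gchoose (i + 2)) * w ^ (i + 2))) sums
      (4 * pi * sqrt (m_reg k) * sqrt n * (sqrt (1 + w) - 1 - w / 2))"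
    by (rule sums_mult)
  also have "(\<lambda>i. 4 * pi * sqrt (m_reg k) * sqrt n * (((1 / 2) gchoose (i + 2)) * w ^ (i + 2))) =
      (\<lambda>i. let r = i + 2 in 4 * pi * sqrt (m_reg k) * ((1 / 2) gchoose r) / real n powr (real r - 1 / 2))"
  proof
    fix i
    have "real n powr (real (i + 2) - 1 / 2) = real n powr real (i + 2) / real n powr (1 / 2)"
      by (rule powr_diff)
    also have "real n powr real (i + 2) = real n ^ (i + 2)"
      using w by (intro powr_realpow) simp
    finally have "real n powr (real (i + 2) - 1 / 2) = real n ^ (i + 2) / sqrt n"
      using w by (simp add: powr_half_sqrt)
    then show "4 * pi * sqrt (m_reg k) * sqrt n * (((1 / 2) gchoose (i + 2)) * w ^ (i + 2)) =
      (let r = i + 2 in 4 * pi * sqrt (m_reg k) * ((1 / 2) gchoose r) / real n powr (real r - 1 / 2))"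
      using w by (simp add: Let_def w_def power_divide)
  qed
  finally have "(\<Sum>i. let r = i + 2 in 4 * pi * sqrt (m_reg k) * ((1 / 2) gchoose r) / real n powr (real r - 1 / 2)) =
      4 * pi * sqrt (m_reg k) * sqrt n * (sqrt (1 + w) - 1 - w / 2)"
    by (rule sums_unique[symmetric])
  then show ?thesis
    unfolding delta_reg_def by (simp add: w_def algebra_simps)
qed

lemma m_reg_pos: "k \<ge> 2 \<Longrightarrow> m_reg k > 0"
  by (simp add: m_reg_def)

text \<open>From 1 + w / 2 - sqrt (1 + w) being asymptotic to w^2 / 8 at w = 1 / n.\<close>

lemma delta_reg_asymp:
  assumes "k \<ge> 2"
  shows "(\<lambda>n. (delta_reg k n)\<^sup>2 * real n powr (3 / 2)) \<longlonglongrightarrow> pi * sqrt (m_reg k) / 2"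
    and "\<forall>\<^sub>F n in sequentially. delta_reg k n > 0"
proof -
  have lim: "(\<lambda>n. sqrt n * (1 + 1 / (2 * real n) - sqrt (1 + 1 / real n)) * real n powr (3 / 2)) \<longlonglongrightarrow> 1 / 8"
    by real_asymp
  have pos: "sqrt (m_reg k) > 0"
    using m_reg_pos[OF assms] by simp
  have "\<forall>\<^sub>F n in sequentially. sqrt n * (1 + 1 / (2 * real n) - sqrt (1 + 1 / real n)) > 0"
    by real_asymp
  then have ev: "\<forall>\<^sub>F n in sequentially. delta_reg k n > 0 \<and>
      (delta_reg k n)\<^sup>2 = 4 * pi * sqrt (m_reg k) * (sqrt n * (1 + 1 / (2 * real n) - sqrt (1 + 1 / n)))"
    using eventually_ge_at_top[of 2]
  proof eventually_elim
    case (elim n)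
    then have "4 * pi * sqrt (m_reg k) * (sqrt n * (1 + 1 / (2 * real n) - sqrt (1 + 1 / n))) > 0"
      using pos by (intro mult_pos_pos[OF _ elim(1)]) auto
    then show ?case
      by (simp add: delta_reg_eq[OF elim(2)] less_imp_le)
  qed
  then show "\<forall>\<^sub>F n in sequentially. delta_reg k n > 0"
    by (rule eventually_mono) simp
  have "(\<lambda>n. 4 * pi * sqrt (m_reg k) * (sqrt n * (1 + 1 / (2 * real n) - sqrt (1 + 1 / real n)) * real n powr (3 / 2)))
      \<longlonglongrightarrow> 4 * pi * sqrt (m_reg k) * (1 / 8)"
    by (intro tendsto_mult_left lim)
  then show "(\<lambda>n. (delta_reg k n)\<^sup>2 * real n powr (3 / 2)) \<longlonglongrightarrow> pi * sqrt (m_reg k) / 2"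
  proof (rule Lim_transform_eventually[THEN tendsto_eq_rhs])
    show "\<forall>\<^sub>F n in sequentially. 4 * pi * sqrt (m_reg k) * (sqrt n * (1 + 1 / (2 * real n) - sqrt (1 + 1 / real n)) * real n powr (3 / 2))
        = (delta_reg k n)\<^sup>2 * real n powr (3 / 2)"
      using ev by eventually_elim simp
  qed simp
qed

text \<open>The saddle point: with \<open>c = 4 \<pi>\<^sup>2 m\<close> it minimizes \<open>c / x + n x\<close>.\<close>

definition saddle :: "nat \<Rightarrow> nat \<Rightarrow> real" where
  "saddle k n = 2 * pi * sqrt (m_reg k / real n)"

lemma saddle_pos: "k \<ge> 2 \<Longrightarrow> n > 0 \<Longrightarrow> saddle k n > 0"
  by (simp add: saddle_def m_reg_pos)

lemma saddle_square: "k \<ge> 2 \<Longrightarrow> n > 0 \<Longrightarrow> real n * (saddle k n)\<^sup>2 = 4 * pi\<^sup>2 * m_reg k"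
  using m_reg_pos[of k] by (simp add: saddle_def power_mult_distrib)

lemma saddle_tendsto: "saddle k \<longlonglongrightarrow> 0"
proof -
  have "(\<lambda>n. 2 * pi * sqrt (m_reg k * (1 / real n))) \<longlonglongrightarrow> 2 * pi * sqrt (m_reg k * 0)"
    by (intro tendsto_intros lim_1_over_n)
  then show ?thesis by (simp add: saddle_def[abs_def])
qed

text \<open>This constant fixes the width of the Gaussian: the exponent is close to - c y^2 / x^3,
  which at y = 2 \<delta> u is - 4 c (\<delta>^2 / x^3) u^2 and tends to - u^2.\<close>

lemma delta_reg_saddle:
  assumes "k \<ge> 2"
  shows "(\<lambda>n. (delta_reg k n)\<^sup>2 / saddle k n ^ 3) \<longlonglongrightarrow> 1 / (4 * (4 * pi\<^sup>2 * m_reg k))"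
proof -
  define s where "s = sqrt (m_reg k)"
  have s: "s > 0" "m_reg k = s\<^sup>2" using m_reg_pos[OF assms] by (auto simp: s_def)
  have "(\<lambda>n. (delta_reg k n)\<^sup>2 * real n powr (3 / 2) / (2 * pi * s) ^ 3) \<longlonglongrightarrow> (pi * s / 2) / (2 * pi * s) ^ 3"
    using s delta_reg_asymp(1)[OF assms] unfolding s_def[symmetric] by (intro tendsto_divide) auto
  also have "(pi * s / 2) / (2 * pi * s) ^ 3 = 1 / (4 * (4 * pi\<^sup>2 * m_reg k))"
    using s by (simp add: s(2) power3_eq_cube power2_eq_square)
  finally show ?thesis
  proof (rule Lim_transform_eventually)
    show "\<forall>\<^sub>F n in sequentially. (delta_reg k n)\<^sup>2 * real n powr (3 / 2) / (2 * pi * s) ^ 3 = (delta_reg k n)\<^sup>2 / saddle k n ^ 3"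
      using eventually_gt_at_top[of 0]
    proof eventually_elim
      case (elim n)
      have "saddle k n = 2 * pi * s * real n powr (- 1 / 2)"
        using elim by (simp add: saddle_def s_def real_sqrt_divide powr_minus powr_half_sqrt field_simps)
      then have "saddle k n ^ 3 = (2 * pi * s) ^ 3 * (real n powr (- 1 / 2)) ^ 3"
        by (simp add: power_mult_distrib)
      also have "(real n powr (- 1 / 2)) ^ 3 = real n powr (- 3 / 2)"
        using elim by (simp flip: powr_realpow add: powr_powr)
      finally have "(2 * pi * s) ^ 3 = saddle k n ^ 3 * real n powr (3 / 2)"
        using elim by (simp add: mult.assoc flip: powr_add)
      then show ?case
        using elim by simp
    qed
  qed
qed

text \<open>The leading term of A is the saddle point itself. The finite sum that remains is of
  order at most 1 / n, while \<delta> is of order n^(-3/4); both are compared after multiplication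
  by n^(3/4).\<close>

lemma A_reg_saddle:
  assumes "k \<ge> 2"
  shows "(\<lambda>n. (saddle k n - A_reg k d n) / delta_reg k n) \<longlonglongrightarrow> 0"
proof -
  define M where "M = nat \<lfloor>3 * real d / 4\<rfloor>"
  have "(\<lambda>n. - (3 / 4) * (\<Sum>r = 1..M. (-1) ^ r / real r * (real n powr (3 / 4) / real n ^ r))) \<longlonglongrightarrow>
      - (3 / 4) * (\<Sum>r = 1..M. (-1) ^ r / real r * 0)"
  proof (intro tendsto_intros)
    fix r assume "r \<in> {1..M}"
    then obtain s where r: "r = Suc s" by (cases r) auto
    have "(\<lambda>n. (real n powr (3 / 4) / real n) * (1 / real n) ^ s) \<longlonglongrightarrow> 0 * 0 ^ s"
      by (intro tendsto_intros lim_1_over_n) real_asymp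
    then show "(\<lambda>n. real n powr (3 / 4) / real n ^ r) \<longlonglongrightarrow> 0"
      by (simp add: r power_divide)
  qed
  then have 1: "(\<lambda>n. - (3 / 4) * (\<Sum>r = 1..M. (-1) ^ r / real r * (real n powr (3 / 4) / real n ^ r))) \<longlonglongrightarrow> 0"
    by simp
  have 2: "(\<lambda>n. sqrt ((delta_reg k n)\<^sup>2 * real n powr (3 / 2))) \<longlonglongrightarrow> sqrt (pi * sqrt (m_reg k) / 2)"
    by (intro tendsto_real_sqrt delta_reg_asymp assms)
  have "(\<lambda>n. (- (3 / 4) * (\<Sum>r = 1..M. (-1) ^ r / real r * (real n powr (3 / 4) / real n ^ r))) /
      sqrt ((delta_reg k n)\<^sup>2 * real n powr (3 / 2))) \<longlonglongrightarrow> 0 / sqrt (pi * sqrt (m_reg k) / 2)"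
    using m_reg_pos[OF assms] by (intro tendsto_divide 1 2) auto
  then have "(\<lambda>n. (- (3 / 4) * (\<Sum>r = 1..M. (-1) ^ r / real r * (real n powr (3 / 4) / real n ^ r))) /
      sqrt ((delta_reg k n)\<^sup>2 * real n powr (3 / 2))) \<longlonglongrightarrow> 0"
    by simp
  then show ?thesis
  proof (rule Lim_transform_eventually)
    show "\<forall>\<^sub>F n in sequentially. (- (3 / 4) * (\<Sum>r = 1..M. (-1) ^ r / real r * (real n powr (3 / 4) / real n ^ r))) /
      sqrt ((delta_reg k n)\<^sup>2 * real n powr (3 / 2)) = (saddle k n - A_reg k d n) / delta_reg k n"
      using eventually_gt_at_top[of 0] delta_reg_asymp(2)[OF assms]
    proof eventually_elim
      case (elim n)
      define P where "P = real n powr (3 / 4)"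
      have P: "P > 0" using elim by (simp add: P_def)
      have "real n powr (3 / 2) = P\<^sup>2"
        using elim by (simp add: P_def powr_powr flip: powr_realpow)
      then have "sqrt ((delta_reg k n)\<^sup>2 * real n powr (3 / 2)) = delta_reg k n * P"
        using elim P by (simp add: real_sqrt_mult)
      moreover have "(\<Sum>r = 1..M. (-1) ^ r / real r * (P / real n ^ r)) = P * (\<Sum>r = 1..M. (-1) ^ r / (real r * real n ^ r))"
        by (simp add: sum_distrib_left mult_ac)
      moreover have "saddle k n - A_reg k d n = - (3 / 4) * (\<Sum>r = 1..M. (-1) ^ r / (real r * real n ^ r))"
        by (simp add: saddle_def A_reg_def M_def)
      ultimately show ?case
        using P elim unfolding P_def[symmetric] by simp
    qed
  qed
qed

section \<open>The saddle point limit\<close>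

lemma p_reg_gf_decay:
  assumes k: "k \<ge> 2" and x: "0 < x" "x \<le> 1" and y: "\<bar>y\<bar> \<le> pi"
  shows "norm (p_reg_gf k (exp (- Complex x y))) \<le> norm (p_reg_gf k (exp (- of_real x))) *
    exp (- (1 / (exp 1 * pi\<^sup>2 * k)) * (y\<^sup>2 / (x * (x\<^sup>2 + y\<^sup>2))))"
proof -
  define q where "q = exp (- Complex x y)"
  have q: "norm q < 1" "complex_of_real (norm q) = exp (- of_real x)"
    using x by (simp_all add: q_def exp_of_real[symmetric])
  have "norm (p_reg_gf k q) \<le> norm (p_reg_gf k (of_real (norm q))) *
      exp (- (norm q / (1 - norm q) - Re (q / (1 - q))) / (2 * k))"
    by (rule norm_p_reg_gf_le[OF q(1) k])
  also have "\<dots> \<le> norm (p_reg_gf k (of_real (norm q))) *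
    exp (- ((2 / (exp 1 * pi\<^sup>2)) * (y\<^sup>2 / (x * (x\<^sup>2 + y\<^sup>2)))) / (2 * k))"
  proof (rule mult_left_mono)
    define G where "G = norm q / (1 - norm q) - Re (q / (1 - q))"
    define a where "a = (2 / (exp 1 * pi\<^sup>2)) * (y\<^sup>2 / (x * (x\<^sup>2 + y\<^sup>2)))"
    have "a \<le> G"
      using geometric_gap_ge[OF x y] by (simp only: G_def a_def q_def)
    then have "exp (- G / (2 * k)) \<le> exp (- a / (2 * k))"
      by (simp add: divide_right_mono)
    then show "exp (- (norm q / (1 - norm q) - Re (q / (1 - q))) / (2 * k)) \<le>
        exp (- ((2 / (exp 1 * pi\<^sup>2)) * (y\<^sup>2 / (x * (x\<^sup>2 + y\<^sup>2)))) / (2 * k))"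
      by (simp only: G_def a_def)
  qed simp
  also have "- ((2 / (exp 1 * pi\<^sup>2)) * (y\<^sup>2 / (x * (x\<^sup>2 + y\<^sup>2)))) / (2 * k) =
      - (1 / (exp 1 * pi\<^sup>2 * k)) * (y\<^sup>2 / (x * (x\<^sup>2 + y\<^sup>2)))"
    by simp
  finally show ?thesis
    unfolding q(2) unfolding q_def .
qed

lemma bounded_poly_times_exp:
  fixes c :: real
  assumes "c > 0"
  obtains B where "\<And>t. t \<ge> 0 \<Longrightarrow> (1 + t) ^ M * exp (- c * t) \<le> B"
proof
  fix t :: real assume t: "t \<ge> 0"
  have "(\<Sum>n\<in>{M}. (c * (1 + t)) ^ n /\<^sub>R fact n) \<le> (\<Sum>n. (c * (1 + t)) ^ n /\<^sub>R fact n)"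
    using assms t summable_exp_generic[of "c * (1 + t)"] by (intro sum_le_suminf) auto
  then have "(c * (1 + t)) ^ M / fact M \<le> exp (c * (1 + t))"
    by (simp add: exp_def field_simps)
  then have "(1 + t) ^ M \<le> fact M / c ^ M * exp (c * (1 + t))"
    using assms unfolding power_mult_distrib by (simp add: field_simps)
  then have "(1 + t) ^ M * exp (- c * t) \<le> fact M / c ^ M * exp (c * (1 + t)) * exp (- c * t)"
    by (intro mult_right_mono) auto
  also have "\<dots> = fact M / c ^ M * exp c"
    by (simp add: algebra_simps flip: exp_add)
  finally show "(1 + t) ^ M * exp (- c * t) \<le> fact M / c ^ M * exp c" .
qed

lemma norm_exp_minus_one_le: "norm (exp w - 1) \<le> exp \<bar>Re w\<bar> * norm w" for w :: complex
  using Taylor_exp[of w 0] by simp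

lemma norm_exp_minus_one_minus_le: "norm (exp w - 1 - w) \<le> exp \<bar>Re w\<bar> * (norm w)\<^sup>2" for w :: complex
  using Taylor_exp[of w 1] by (simp add: algebra_simps power2_eq_square)

text \<open>\<open>jensen_integrand\<close> at y = 2 \<delta> u, divided by the value of P(exp (-z))
  exp (n z) at y = 0. That value cancels in the quotient of two integrals.\<close>

definition scaled_integrand :: "nat \<Rightarrow> nat \<Rightarrow> real \<Rightarrow> real \<Rightarrow> real \<Rightarrow> nat \<Rightarrow> nat \<Rightarrow> real \<Rightarrow> complex" where
  "scaled_integrand k n x A \<delta> l j u = (let z = Complex x (2 * \<delta> * u) in
     indicator {-pi..pi} (2 * \<delta> * u) *\<^sub>R
     (p_reg_gf k (exp (- z)) / p_reg_gf k (exp (- of_real x)) * exp (of_nat n * (z - of_real x)) *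
      exp (z - of_real A) ^ j * ((1 - exp (z - of_real A)) / of_real \<delta>) ^ l))"

text \<open>Let E be the fraction on the right. If \<bar>y\<bar> \<le> x, then E \<ge> y^2 / (2
  x^3), which is at least 2 \<kappa> u^2. Otherwise E \<ge> 1 / (2 x), whereas u^2 may be as large
  as \<pi>^2 / (4 \<kappa> x^3); this range forces the cube.\<close>

lemma one_plus_square_le:
  fixes x y \<delta> u \<kappa> :: real
  assumes x: "0 < x" and \<kappa>: "\<kappa> > 0" and \<delta>: "\<kappa> * x ^ 3 \<le> \<delta>\<^sup>2" "0 < \<delta>" and y: "y = 2 * \<delta> * u" "\<bar>y\<bar> \<le> pi"
  shows "1 + u\<^sup>2 \<le> (1 + 1 / (2 * \<kappa>) + 2 * pi\<^sup>2 / \<kappa>) * (1 + y\<^sup>2 / (x * (x\<^sup>2 + y\<^sup>2))) ^ 3"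
proof -
  define E where "E = y\<^sup>2 / (x * (x\<^sup>2 + y\<^sup>2))"
  have E: "E \<ge> 0" using x by (simp add: E_def)
  have E1: "1 \<le> (1 + E) ^ 3" "E \<le> (1 + E) ^ 3" "E ^ 3 \<le> (1 + E) ^ 3"
    using E power_increasing[of 1 3 "1 + E"] power_mono[of E "1 + E" 3] by auto
  have "u\<^sup>2 \<le> 1 / (2 * \<kappa>) * E + 2 * pi\<^sup>2 / \<kappa> * E ^ 3"
  proof (cases "\<bar>y\<bar> \<le> x")
    case True
    then have y2: "y\<^sup>2 \<le> x\<^sup>2" using abs_le_square_iff[of y x] x by auto
    have "2 * \<kappa> * u\<^sup>2 * x ^ 3 = 2 * u\<^sup>2 * (\<kappa> * x ^ 3)" by simp
    also have "\<dots> \<le> 2 * u\<^sup>2 * \<delta>\<^sup>2" by (intro mult_left_mono \<delta>) auto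
    also have "\<dots> = y\<^sup>2 / 2" by (simp add: y power_mult_distrib)
    finally have "2 * \<kappa> * u\<^sup>2 \<le> y\<^sup>2 / (2 * x ^ 3)"
      using x by (simp add: pos_le_divide_eq)
    also have "\<dots> \<le> E"
      unfolding E_def using x y2
      by (intro divide_left_mono) (auto simp: power3_eq_cube power2_eq_square intro!: mult_pos_pos add_pos_nonneg)
    finally have "u\<^sup>2 \<le> 1 / (2 * \<kappa>) * E" using \<kappa> by (simp add: field_simps)
    then show ?thesis using E \<kappa> by (smt (verit) divide_nonneg_pos mult_nonneg_nonneg zero_le_power zero_le_power2)
  next
    case False
    then have y2: "x\<^sup>2 \<le> y\<^sup>2" "y \<noteq> 0" using abs_le_square_iff[of x y] x by auto
    then have "1 / (2 * x) = y\<^sup>2 / (x * (y\<^sup>2 + y\<^sup>2))" by simp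
    also have "\<dots> \<le> E"
      unfolding E_def using x y2
      by (intro divide_left_mono mult_left_mono add_right_mono mult_pos_pos add_pos_nonneg) auto
    finally have "(1 / (2 * x)) ^ 3 \<le> E ^ 3" using x by (intro power_mono) auto
    then have xE: "1 / x ^ 3 \<le> 8 * E ^ 3"
      by (simp add: power_divide power_mult_distrib field_simps)
    have "u\<^sup>2 = y\<^sup>2 / (4 * \<delta>\<^sup>2)" using \<delta> by (simp add: y power_mult_distrib)
    also have "\<dots> \<le> pi\<^sup>2 / (4 * (\<kappa> * x ^ 3))"
      using \<delta> \<kappa> x y abs_le_square_iff[of y pi] by (intro frac_le) auto
    also have "\<dots> = pi\<^sup>2 / (4 * \<kappa>) * (1 / x ^ 3)" by simp
    also have "\<dots> \<le> pi\<^sup>2 / (4 * \<kappa>) * (8 * E ^ 3)"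
      using \<kappa> by (intro mult_left_mono xE) auto
    also have "\<dots> = 2 * pi\<^sup>2 / \<kappa> * E ^ 3" by simp
    finally show ?thesis using E \<kappa> by (smt (verit) divide_nonneg_pos mult_nonneg_nonneg)
  qed
  also have "\<dots> \<le> 1 / (2 * \<kappa>) * (1 + E) ^ 3 + 2 * pi\<^sup>2 / \<kappa> * (1 + E) ^ 3"
    using \<kappa> by (intro add_mono mult_left_mono E1) auto
  finally have "1 + u\<^sup>2 \<le> (1 + E) ^ 3 + (1 / (2 * \<kappa>) * (1 + E) ^ 3 + 2 * pi\<^sup>2 / \<kappa> * (1 + E) ^ 3)"
    using E1(1) by linarith
  also have "\<dots> = (1 + 1 / (2 * \<kappa>) + 2 * pi\<^sup>2 / \<kappa>) * (1 + E) ^ 3"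
    by (simp only: distrib_right mult_1)
  finally show ?thesis by (simp only: E_def)
qed

text \<open>The factor exp (n (z - x)) has modulus 1, so \<open>n\<close> drops out. The power
  \<open>l\<close> grows at most like (1 + u^2)^l, hence polynomially in E, and exp (-c E) absorbs
  it.\<close>

lemma scaled_integrand_bound:
  assumes k: "k \<ge> 2" and \<kappa>: "\<kappa> > 0"
  obtains B where "\<And>n x A \<delta> u. 0 < x \<Longrightarrow> x \<le> 1 \<Longrightarrow> 0 < \<delta> \<Longrightarrow> \<delta> \<le> 1 \<Longrightarrow> \<kappa> * x ^ 3 \<le> \<delta>\<^sup>2 \<Longrightarrow> \<bar>x - A\<bar> \<le> \<delta> \<Longrightarrow>
    norm (scaled_integrand k n x A \<delta> l j u) \<le> B * (1 / (1 + u\<^sup>2))"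
proof -
  define c where "c = 1 / (exp 1 * pi\<^sup>2 * k)"
  have c: "c > 0" using k by (simp add: c_def)
  define C where "C = 1 + 1 / (2 * \<kappa>) + 2 * pi\<^sup>2 / \<kappa>"
  have C: "C > 0" using \<kappa> by (auto simp: C_def intro!: add_pos_nonneg)
  \<comment> \<open>Exponent: 3 for each factor 1 + u^2, with \<open>l\<close> such factors from the
    integrand and one more to leave the integrable 1 / (1 + u^2).\<close>
  obtain B where B: "(1 + t) ^ (3 * (l + 1)) * exp (- c * t) \<le> B" if "t \<ge> 0" for t
    using bounded_poly_times_exp[OF c, of "3 * (l + 1)"] by blast
  define D where "D = exp 1 ^ j * (2 * exp (1 :: real)) ^ l * (C ^ (l + 1) * B)"
  show ?thesis
  proof (rule that[of D])
    fix n x A \<delta> u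
    assume x: "0 < x" "x \<le> (1 :: real)" and \<delta>: "0 < \<delta>" "\<delta> \<le> (1 :: real)" "\<kappa> * x ^ 3 \<le> \<delta>\<^sup>2"
      and A: "\<bar>x - A\<bar> \<le> \<delta>"
    have B0: "0 \<le> B" using B[of 0] by auto
    show "norm (scaled_integrand k n x A \<delta> l j u) \<le> D * (1 / (1 + u\<^sup>2))"
    proof (cases "\<bar>2 * \<delta> * u\<bar> \<le> pi")
      case False
      then have "scaled_integrand k n x A \<delta> l j u = 0"
        by (auto simp: scaled_integrand_def Let_def split: split_indicator)
      moreover have "0 \<le> D" using B0 C by (auto simp: D_def)
      ultimately show ?thesis by simp
    next
      case True
      define y where "y = 2 * \<delta> * u"
      define E where "E = y\<^sup>2 / (x * (x\<^sup>2 + y\<^sup>2))"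
      have E: "E \<ge> 0" using x by (simp add: E_def)
      define z where "z = Complex x y"
      define w where "w = z - of_real A"
      have w: "Re w = x - A" "Im w = y" by (simp_all add: w_def z_def)
      have u: "1 + u\<^sup>2 \<le> C * (1 + E) ^ 3"
        unfolding C_def E_def
        by (rule one_plus_square_le[OF x(1) \<kappa> \<delta>(3,1) y_def True[folded y_def]])
      have P0: "p_reg_gf k (exp (- of_real x)) \<noteq> 0"
        using p_reg_gf_of_real_nonzero[of "exp (-x)" k] x by (simp add: exp_of_real[symmetric])
      have 1: "norm (p_reg_gf k (exp (- z)) / p_reg_gf k (exp (- of_real x))) \<le> exp (- c * E)"
        using p_reg_gf_decay[OF k x True[folded y_def]] P0
        by (simp add: norm_divide z_def c_def E_def pos_divide_le_eq mult.commute)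
      have 2: "norm (exp (of_nat n * (z - of_real x))) = 1"
        by (simp add: z_def)
      have 3: "norm (exp w ^ j) \<le> exp 1 ^ j"
        using A \<delta> by (auto simp: norm_power w intro!: power_mono)
      have "norm (1 - exp w) \<le> exp \<bar>Re w\<bar> * norm w"
        using norm_exp_minus_one_le[of w] by (simp add: norm_minus_commute)
      also have "\<dots> \<le> exp 1 * (\<delta> + 2 * \<delta> * \<bar>u\<bar>)"
        using cmod_le[of w] A \<delta> by (intro mult_mono) (auto simp: w y_def abs_mult)
      finally have "norm ((1 - exp w) / of_real \<delta>) \<le> exp 1 * (1 + 2 * \<bar>u\<bar>)"
        using \<delta> by (simp add: norm_divide field_simps)
      also have "1 + 2 * \<bar>u\<bar> \<le> 2 * (1 + u\<^sup>2)"
        using zero_le_power2[of "\<bar>u\<bar> - 1"] by (simp add: power2_diff) (smt (verit) zero_le_power2)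
      finally have "norm ((1 - exp w) / of_real \<delta>) \<le> 2 * exp 1 * (1 + u\<^sup>2)"
        by (simp add: algebra_simps)
      then have 4: "norm (((1 - exp w) / of_real \<delta>) ^ l) \<le> (2 * exp 1 * (1 + u\<^sup>2)) ^ l"
        unfolding norm_power by (intro power_mono) auto
      have "scaled_integrand k n x A \<delta> l j u = p_reg_gf k (exp (- z)) / p_reg_gf k (exp (- of_real x)) *
          exp (of_nat n * (z - of_real x)) * exp w ^ j * ((1 - exp w) / of_real \<delta>) ^ l"
        using True by (auto simp: scaled_integrand_def Let_def w_def z_def y_def abs_le_iff split: split_indicator)
      then have "norm (scaled_integrand k n x A \<delta> l j u) =
          norm (p_reg_gf k (exp (- z)) / p_reg_gf k (exp (- of_real x))) *
          norm (exp (of_nat n * (z - of_real x))) * norm (exp w ^ j) * norm (((1 - exp w) / of_real \<delta>) ^ l)"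
        by (simp only: norm_mult)
      also have "\<dots> \<le> exp (- c * E) * 1 * exp 1 ^ j * (2 * exp 1 * (1 + u\<^sup>2)) ^ l"
        by (intro mult_mono 1 3 4 eq_refl[OF 2]) auto
      also have "\<dots> = exp 1 ^ j * (2 * exp 1) ^ l * ((1 + u\<^sup>2) ^ (l + 1) * exp (- c * E)) * (1 / (1 + u\<^sup>2))"
      proof -
        have "1 + u\<^sup>2 \<noteq> 0" using zero_le_power2[of u] by linarith
        then show ?thesis by (simp add: power_mult_distrib)
      qed
      also have "\<dots> \<le> exp 1 ^ j * (2 * exp 1) ^ l * (C ^ (l + 1) * B) * (1 / (1 + u\<^sup>2))"
      proof (intro mult_right_mono mult_left_mono)
        have "(1 + u\<^sup>2) ^ (l + 1) * exp (- c * E) \<le> (C * (1 + E) ^ 3) ^ (l + 1) * exp (- c * E)"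
          using u by (intro mult_right_mono power_mono) auto
        also have "\<dots> = C ^ (l + 1) * ((1 + E) ^ (3 * (l + 1)) * exp (- c * E))"
          unfolding power_mult_distrib power_mult by simp
        also have "\<dots> \<le> C ^ (l + 1) * B"
          using B[OF E] C by (intro mult_left_mono) auto
        finally show "(1 + u\<^sup>2) ^ (l + 1) * exp (- c * E) \<le> C ^ (l + 1) * B" .
      qed (auto simp: add_nonneg_nonneg)
      finally show ?thesis by (simp only: D_def)
    qed
  qed
qed

section \<open>Pointwise limit of the scaled integrand\<close>

lemma scaled_integrand_tendsto:
  fixes x A \<delta> :: "nat \<Rightarrow> real"
  assumes k: "k \<ge> 2"
    and pos: "\<forall>\<^sub>F n in sequentially. x n > 0 \<and> \<delta> n > 0 \<and> real n * (x n)\<^sup>2 = c"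
    and c: "c = 4 * pi\<^sup>2 * m_reg k"
    and x0: "x \<longlonglongrightarrow> 0"
    and \<delta>: "(\<lambda>n. (\<delta> n)\<^sup>2 / x n ^ 3) \<longlonglongrightarrow> 1 / (4 * c)"
    and A: "(\<lambda>n. (x n - A n) / \<delta> n) \<longlonglongrightarrow> 0"
  shows "(\<lambda>n. scaled_integrand k n (x n) (A n) (\<delta> n) l j u) \<longlonglongrightarrow> of_real (exp (- u\<^sup>2)) * (- 2 * \<i> * of_real u) ^ l"
proof -
  have c0: "c > 0" using k by (simp add: c m_reg_def)
  define y where "y n = 2 * \<delta> n * u" for n
  define z where "z n = Complex (x n) (y n)" for n
  define w where "w n = z n - of_real (A n)" for n
  have "(\<lambda>n. sqrt ((\<delta> n)\<^sup>2 / x n ^ 3 * x n)) \<longlonglongrightarrow> sqrt (1 / (4 * c) * 0)"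
    by (intro tendsto_intros \<delta> x0)
  then have \<delta>x: "(\<lambda>n. \<delta> n / x n) \<longlonglongrightarrow> 0"
  proof (rule Lim_transform_eventually[THEN tendsto_eq_rhs])
    show "\<forall>\<^sub>F n in sequentially. sqrt ((\<delta> n)\<^sup>2 / x n ^ 3 * x n) = \<delta> n / x n"
      using pos
    proof eventually_elim
      case (elim n)
      then have "(\<delta> n)\<^sup>2 / x n ^ 3 * x n = (\<delta> n / x n)\<^sup>2"
        by (simp add: power_divide power3_eq_cube power2_eq_square)
      then show ?case using elim by simp
    qed
  qed simp
  have "(\<lambda>n. \<delta> n / x n * x n) \<longlonglongrightarrow> 0 * 0"
    by (intro tendsto_mult \<delta>x x0)
  then have \<delta>0: "\<delta> \<longlonglongrightarrow> 0"
    by (rule Lim_transform_eventually[THEN tendsto_eq_rhs]) (use pos in \<open>auto elim!: eventually_mono\<close>)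
  have "(\<lambda>n. 2 * u * (\<delta> n / x n)) \<longlonglongrightarrow> 2 * u * 0" "(\<lambda>n. 2 * u * \<delta> n) \<longlonglongrightarrow> 2 * u * 0"
    by (intro tendsto_mult_left \<delta>x \<delta>0)+
  then have yx: "(\<lambda>n. y n / x n) \<longlonglongrightarrow> 0" and y0: "y \<longlonglongrightarrow> 0"
    by (simp_all add: y_def[abs_def] mult_ac)
  have ev_yx: "\<forall>\<^sub>F n in sequentially. \<bar>y n\<bar> \<le> x n"
  proof -
    have "\<forall>\<^sub>F n in sequentially. \<bar>y n / x n\<bar> < 1"
      using tendsto_rabs[OF yx] by (intro order_tendstoD) auto
    then show ?thesis using pos
      by eventually_elim (auto simp: abs_divide)
  qed
  have ev_pi: "\<forall>\<^sub>F n in sequentially. \<bar>y n\<bar> \<le> pi"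
  proof -
    have "\<forall>\<^sub>F n in sequentially. \<bar>y n\<bar> < pi"
      using tendsto_rabs[OF y0] by (intro order_tendstoD) auto
    then show ?thesis by (rule eventually_mono) simp
  qed
  obtain K where K: "\<And>x y. x > 0 \<Longrightarrow> \<bar>y\<bar> \<le> x \<Longrightarrow>
    \<exists>R. norm R \<le> K * (\<bar>y\<bar> * x powr (- 5 / 4)) \<and>
      p_reg_gf k (exp (- Complex x y)) = p_reg_gf k (exp (- of_real x)) *
        exp (of_real (4 * pi\<^sup>2 * m_reg k) * (1 / Complex x y - 1 / of_real x) + R)"
    using p_reg_gf_near_axis[OF k] by blast
  \<comment> \<open>The conditions are placed inside the existential so that \<open>R\<close> can be
    chosen as a total sequence; they hold only for large n.\<close>
  have "\<forall>n. \<exists>R. x n > 0 \<longrightarrow> \<bar>y n\<bar> \<le> x n \<longrightarrow> norm R \<le> K * (\<bar>y n\<bar> * x n powr (- 5 / 4)) \<and>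
      p_reg_gf k (exp (- z n)) = p_reg_gf k (exp (- of_real (x n))) * exp (of_real c * (1 / z n - 1 / of_real (x n)) + R)"
    using K unfolding z_def c by blast
  from choice[OF this] obtain R where RR: "\<forall>n. x n > 0 \<longrightarrow> \<bar>y n\<bar> \<le> x n \<longrightarrow> norm (R n) \<le> K * (\<bar>y n\<bar> * x n powr (- 5 / 4)) \<and>
      p_reg_gf k (exp (- z n)) = p_reg_gf k (exp (- of_real (x n))) * exp (of_real c * (1 / z n - 1 / of_real (x n)) + R n)" ..
  have R: "norm (R n) \<le> K * (\<bar>y n\<bar> * x n powr (- 5 / 4))"
      "p_reg_gf k (exp (- z n)) = p_reg_gf k (exp (- of_real (x n))) * exp (of_real c * (1 / z n - 1 / of_real (x n)) + R n)"
    if "x n > 0" "\<bar>y n\<bar> \<le> x n" for n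
    using RR[rule_format, OF that, THEN conjunct1] RR[rule_format, OF that, THEN conjunct2] by this
  \<comment> \<open>Since \<bar>y\<bar> = 2 \<delta> \<bar>u\<bar> and \<delta> = sqrt (\<delta>^2 /
    x^3) x^(3/2), the bound is a convergent factor times x^(3/2 - 5/4) = x^(1/4).\<close>
  have R0: "R \<longlonglongrightarrow> 0"
  proof (rule Lim_null_comparison)
    show "\<forall>\<^sub>F n in sequentially. norm (R n) \<le> K * (2 * \<bar>u\<bar> * (sqrt ((\<delta> n)\<^sup>2 / x n ^ 3) * x n powr (1 / 4)))"
      using pos ev_yx
    proof eventually_elim
      case (elim n)
      have "x n ^ 3 = x n powr 3"
        using elim by (simp add: powr_numeral)
      then have "sqrt (x n ^ 3) = (x n powr 3) powr (1 / 2)"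
        using elim by (simp only: powr_half_sqrt powr_ge_zero)
      also have "\<dots> = x n powr (3 / 2)"
        by (simp only: powr_powr) simp
      finally have "sqrt ((\<delta> n)\<^sup>2 / x n ^ 3) * x n powr (1 / 4) = \<delta> n * (x n powr (1 / 4) / x n powr (3 / 2))"
        using elim by (simp add: real_sqrt_divide)
      also have "x n powr (1 / 4) / x n powr (3 / 2) = x n powr (- 5 / 4)"
        by (subst powr_diff[symmetric]) simp
      finally show ?case
        using R(1)[of n] elim by (simp add: y_def abs_mult mult_ac)
    qed
    have "(\<lambda>n. K * (2 * \<bar>u\<bar> * (sqrt ((\<delta> n)\<^sup>2 / x n ^ 3) * x n powr (1 / 4)))) \<longlonglongrightarrow>
        K * (2 * \<bar>u\<bar> * (sqrt (1 / (4 * c)) * 0))"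
      using pos by (intro tendsto_mult tendsto_const tendsto_real_sqrt \<delta> tendsto_zero_powrI[OF x0 tendsto_const])
        (auto elim!: eventually_mono)
    then show "(\<lambda>n. K * (2 * \<bar>u\<bar> * (sqrt ((\<delta> n)\<^sup>2 / x n ^ 3) * x n powr (1 / 4)))) \<longlonglongrightarrow> 0"
      by simp
  qed
  have xz: "(\<lambda>n. of_real (x n) / z n) \<longlonglongrightarrow> 1"
  proof -
    have "(\<lambda>n. 1 / (1 + \<i> * of_real (y n / x n))) \<longlonglongrightarrow> 1 / (1 + \<i> * of_real 0)"
      by (intro tendsto_intros yx) auto
    then have "(\<lambda>n. 1 / (1 + \<i> * of_real (y n / x n))) \<longlonglongrightarrow> 1"
      by simp
    then show ?thesis
    proof (rule Lim_transform_eventually)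
      show "\<forall>\<^sub>F n in sequentially. 1 / (1 + \<i> * of_real (y n / x n)) = of_real (x n) / z n"
        using pos
      proof eventually_elim
        case (elim n)
        have "z n = of_real (x n) * (1 + \<i> * of_real (y n / x n))"
          using elim by (simp add: z_def complex_eq_iff)
        then show ?case using elim by simp
      qed
    qed
  qed
  have main: "(\<lambda>n. p_reg_gf k (exp (- z n)) / p_reg_gf k (exp (- of_real (x n))) * exp (of_nat n * (z n - of_real (x n))))
      \<longlonglongrightarrow> of_real (exp (- u\<^sup>2))"
  proof -
    have "(\<lambda>n. exp (- (of_real (4 * c * ((\<delta> n)\<^sup>2 / x n ^ 3) * u\<^sup>2) * (of_real (x n) / z n)) + R n)) \<longlonglongrightarrow>
        exp (- (of_real (4 * c * (1 / (4 * c)) * u\<^sup>2) * 1) + 0)"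
      by (intro tendsto_intros \<delta> xz R0)
    also have "exp (- (of_real (4 * c * (1 / (4 * c)) * u\<^sup>2) * 1) + 0) = complex_of_real (exp (- u\<^sup>2))"
      using c0 by (simp add: exp_of_real[symmetric])
    finally show ?thesis
    proof (rule Lim_transform_eventually)
      show "\<forall>\<^sub>F n in sequentially. exp (- (of_real (4 * c * ((\<delta> n)\<^sup>2 / x n ^ 3) * u\<^sup>2) * (of_real (x n) / z n)) + R n) =
        p_reg_gf k (exp (- z n)) / p_reg_gf k (exp (- of_real (x n))) * exp (of_nat n * (z n - of_real (x n)))"
        using pos ev_yx
      proof eventually_elim
        case (elim n)
        define X where "X = complex_of_real (x n)"
        have X: "X \<noteq> 0" "z n \<noteq> 0" using elim by (auto simp: X_def z_def complex_eq_iff)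
        have P0: "p_reg_gf k (exp (- X)) \<noteq> 0"
          using p_reg_gf_of_real_nonzero[of "exp (- x n)" k] elim by (simp add: X_def exp_of_real[symmetric])
        have "complex_of_real c = of_real (real n * (x n)\<^sup>2)" using elim by simp
        then have n: "of_nat n = of_real c / X\<^sup>2" using X by (simp add: X_def)
        have zX: "(z n - X)\<^sup>2 = - of_real ((y n)\<^sup>2)"
        proof -
          have "z n - X = \<i> * of_real (y n)" by (simp add: z_def X_def complex_eq_iff)
          then show ?thesis by (simp add: power_mult_distrib)
        qed
        \<comment> \<open>An exact identity, because n x^2 = c makes the linear terms cancel; no
          Taylor remainder has to be controlled, only x / z tending to 1.\<close>
        have "of_real c * (1 / z n - 1 / X) + of_nat n * (z n - X) = of_real c * (z n - X)\<^sup>2 / (X\<^sup>2 * z n)"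
          unfolding n using X by (simp add: divide_simps power2_eq_square) (simp add: algebra_simps)
        also have "\<dots> = - (of_real c * of_real ((y n)\<^sup>2) / (X\<^sup>2 * z n))"
          unfolding zX by simp
        also have "of_real c * of_real ((y n)\<^sup>2) / (X\<^sup>2 * z n) = of_real (4 * c * ((\<delta> n)\<^sup>2 / x n ^ 3) * u\<^sup>2) * (X / z n)"
          using X by (simp add: y_def X_def power_mult_distrib power3_eq_cube power2_eq_square field_simps)
        finally have "- (of_real (4 * c * ((\<delta> n)\<^sup>2 / x n ^ 3) * u\<^sup>2) * (X / z n)) + R n =
            (of_real c * (1 / z n - 1 / X) + R n) + of_nat n * (z n - X)" by simp
        then have "exp (- (of_real (4 * c * ((\<delta> n)\<^sup>2 / x n ^ 3) * u\<^sup>2) * (X / z n)) + R n) =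
            exp (of_real c * (1 / z n - 1 / X) + R n) * exp (of_nat n * (z n - X))"
          by (simp only: exp_add)
        also have "exp (of_real c * (1 / z n - 1 / X) + R n) = p_reg_gf k (exp (- z n)) / p_reg_gf k (exp (- X))"
          using R(2)[of n] elim P0 by (simp add: X_def)
        finally show ?case by (simp only: X_def)
      qed
    qed
  qed
  have w\<delta>: "(\<lambda>n. w n / of_real (\<delta> n)) \<longlonglongrightarrow> 2 * \<i> * of_real u"
  proof -
    have "(\<lambda>n. of_real ((x n - A n) / \<delta> n) + 2 * \<i> * of_real u) \<longlonglongrightarrow> of_real 0 + 2 * \<i> * of_real u"
      by (intro tendsto_intros A)
    then have "(\<lambda>n. of_real ((x n - A n) / \<delta> n) + 2 * \<i> * of_real u) \<longlonglongrightarrow> 2 * \<i> * of_real u"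
      by simp
    then show ?thesis
    proof (rule Lim_transform_eventually)
      show "\<forall>\<^sub>F n in sequentially. of_real ((x n - A n) / \<delta> n) + 2 * \<i> * of_real u = w n / of_real (\<delta> n)"
        using pos by eventually_elim (auto simp: w_def z_def y_def Complex_eq field_simps)
    qed
  qed
  have "(\<lambda>n. w n / of_real (\<delta> n) * of_real (\<delta> n)) \<longlonglongrightarrow> 2 * \<i> * of_real u * of_real 0"
    by (intro tendsto_mult w\<delta> tendsto_of_real \<delta>0)
  then have w0: "w \<longlonglongrightarrow> 0"
    by (rule Lim_transform_eventually[THEN tendsto_eq_rhs]) (use pos in \<open>auto elim!: eventually_mono\<close>)
  \<comment> \<open>The remainder is quadratic in w; one factor is divided by \<delta> and stays
    bounded, the other tends to 0.\<close>
  have rem: "(\<lambda>n. (exp (w n) - 1 - w n) / of_real (\<delta> n)) \<longlonglongrightarrow> 0"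
  proof (rule Lim_null_comparison)
    show "\<forall>\<^sub>F n in sequentially. norm ((exp (w n) - 1 - w n) / of_real (\<delta> n)) \<le>
        exp \<bar>Re (w n)\<bar> * norm (w n) * norm (w n / of_real (\<delta> n))"
      using pos
    proof eventually_elim
      case (elim n)
      then show ?case
        using divide_right_mono[OF norm_exp_minus_one_minus_le[of "w n"], of "\<delta> n"]
        by (simp add: norm_divide power2_eq_square mult.assoc)
    qed
    have "(\<lambda>n. exp \<bar>Re (w n)\<bar> * norm (w n) * norm (w n / of_real (\<delta> n))) \<longlonglongrightarrow>
        exp \<bar>Re 0\<bar> * norm (0 :: complex) * norm (2 * \<i> * of_real u)"
      by (intro tendsto_intros w0 w\<delta>)
    then show "(\<lambda>n. exp \<bar>Re (w n)\<bar> * norm (w n) * norm (w n / of_real (\<delta> n))) \<longlonglongrightarrow> 0"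
      by simp
  qed
  have "(\<lambda>n. - ((exp (w n) - 1 - w n) / of_real (\<delta> n)) - w n / of_real (\<delta> n)) \<longlonglongrightarrow> - 0 - 2 * \<i> * of_real u"
    by (intro tendsto_intros rem w\<delta>)
  moreover have "- ((exp (w n) - 1 - w n) / of_real (\<delta> n)) - w n / of_real (\<delta> n) = (1 - exp (w n)) / of_real (\<delta> n)" for n
    by (simp add: diff_divide_distrib)
  ultimately have lin: "(\<lambda>n. (1 - exp (w n)) / of_real (\<delta> n)) \<longlonglongrightarrow> - 2 * \<i> * of_real u"
    by simp
  have "(\<lambda>n. p_reg_gf k (exp (- z n)) / p_reg_gf k (exp (- of_real (x n))) * exp (of_nat n * (z n - of_real (x n))) *
      exp (w n) ^ j * ((1 - exp (w n)) / of_real (\<delta> n)) ^ l) \<longlonglongrightarrow>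
      of_real (exp (- u\<^sup>2)) * exp 0 ^ j * (- 2 * \<i> * of_real u) ^ l"
    by (intro tendsto_mult main tendsto_power tendsto_exp w0 lin)
  then have "(\<lambda>n. p_reg_gf k (exp (- z n)) / p_reg_gf k (exp (- of_real (x n))) * exp (of_nat n * (z n - of_real (x n))) *
      exp (w n) ^ j * ((1 - exp (w n)) / of_real (\<delta> n)) ^ l) \<longlonglongrightarrow>
      of_real (exp (- u\<^sup>2)) * (- 2 * \<i> * of_real u) ^ l"
    by simp
  then show ?thesis
  proof (rule Lim_transform_eventually)
    show "\<forall>\<^sub>F n in sequentially. p_reg_gf k (exp (- z n)) / p_reg_gf k (exp (- of_real (x n))) * exp (of_nat n * (z n - of_real (x n))) *
      exp (w n) ^ j * ((1 - exp (w n)) / of_real (\<delta> n)) ^ l = scaled_integrand k n (x n) (A n) (\<delta> n) l j u"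
      using ev_pi
      by eventually_elim (simp add: scaled_integrand_def Let_def z_def w_def y_def abs_le_iff split: split_indicator; linarith)
  qed
qed

section \<open>Gaussian moments and the coefficients of the Hermite polynomials\<close>

lemma gaussian_moment_complex:
  "(\<integral>u. of_real (exp (- u\<^sup>2)) * (- 2 * \<i> * of_real u) ^ l \<partial>lborel) =
    complex_of_real (sqrt pi * (fact l * (if even l then (-1) ^ (l div 2) / fact (l div 2) else 0)))"
proof -
  define M where "M = sqrt pi * (if even l then fact l / (2 ^ l * fact (l div 2)) else 0)"
  have "has_bochner_integral lborel (\<lambda>u. exp (- u\<^sup>2) * u ^ l) M"
  proof (cases "even l")
    case True
    then obtain m where m: "l = 2 * m" by blast
    show ?thesis
      using has_bochner_integral_even_function[OF gaussian_moment_even_pos[of m]] by (simp add: M_def m)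
  next
    case False
    then obtain m where m: "l = 2 * m + 1" by (elim oddE)
    show ?thesis
      using has_bochner_integral_odd_function[OF gaussian_moment_odd_pos[of m]] by (simp add: M_def m)
  qed
  then have "has_bochner_integral lborel (\<lambda>u. (- 2 * \<i>) ^ l * complex_of_real (exp (- u\<^sup>2) * u ^ l)) ((- 2 * \<i>) ^ l * of_real M)"
    by (intro has_bochner_integral_mult_right has_bochner_integral_of_real)
  also have "(\<lambda>u. (- 2 * \<i>) ^ l * complex_of_real (exp (- u\<^sup>2) * u ^ l)) =
      (\<lambda>u. of_real (exp (- u\<^sup>2)) * (- 2 * \<i> * of_real u) ^ l)"
    by (rule ext) (simp only: power_mult_distrib of_real_mult of_real_power mult_ac)
  \<comment> \<open>For l = 2 m the power 2^l cancels the one in the moment and leaves (-1)^m; for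
    odd l the moment is 0.\<close>
  also have "(- 2 * \<i>) ^ l * of_real M =
      complex_of_real (sqrt pi * (fact l * (if even l then (-1) ^ (l div 2) / fact (l div 2) else 0)))"
  proof (cases "even l")
    case True
    then obtain m where m: "l = 2 * m" by blast
    have "(- 2 * \<i>) ^ l = 2 ^ l * (-1) ^ m"
      by (simp add: m power_mult power_mult_distrib flip: power_mult_distrib)
    then show ?thesis by (simp add: M_def m)
  qed (simp add: M_def)
  finally show ?thesis by (rule has_bochner_integral_integral_eq)
qed

text \<open>The coefficient of t^d in exp (X t) exp (-t^2). It is written in the shape obtained by
  expanding (X - 2 i u)^d and integrating against exp (-u^2) / sqrt \<pi>.\<close>

lemma poly_hermite_poly_sum:
  "poly (hermite_poly d) X = (\<Sum>j\<le>d. real (d choose j) * X ^ j *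
    (fact (d - j) * (if even (d - j) then (-1) ^ ((d - j) div 2) / fact ((d - j) div 2) else 0)))"
proof -
  have "poly (hermite_poly d) X = fact d * fps_nth (fps_exp X * (fps_exp (-1) oo fps_X ^ 2)) d"
    using poly_hermite_poly[of d X] unfolding fps_exp_compose_split by (simp add: field_simps)
  also have "\<dots> = (\<Sum>j\<le>d. fact d * (X ^ j / fact j *
      (if even (d - j) then (-1) ^ ((d - j) div 2) / fact ((d - j) div 2) else 0)))"
    by (simp add: fps_mult_nth fps_nth_compose_X_power sum_distrib_left atMost_atLeast0 cong: if_cong)
  also have "\<dots> = (\<Sum>j\<le>d. real (d choose j) * X ^ j *
    (fact (d - j) * (if even (d - j) then (-1) ^ ((d - j) div 2) / fact ((d - j) div 2) else 0)))"
    by (rule sum.cong) (auto simp: binomial_fact)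
  finally show ?thesis .
qed

section \<open>Passage to the limit under the integral, and uniformity in X\<close>

lemma integrable_inverse_one_plus_square: "integrable lborel (\<lambda>u :: real. 1 / (1 + u\<^sup>2))"
  using integrable_inverse_1_plus_square by (simp add: set_integrable_def inverse_eq_divide)

lemma scaled_integrand_eq_jensen_integrand:
  "scaled_integrand k n x A \<delta> l j u = jensen_integrand k n x A \<delta> l j (2 * \<delta> * u) /
      (p_reg_gf k (exp (- of_real x)) * exp (of_nat n * of_real x))"
  by (simp add: scaled_integrand_def jensen_integrand_def Let_def right_diff_distrib exp_diff split: split_indicator)

lemma integral_jensen_integrand:
  assumes "x > 0" "\<delta> > 0"
  shows "(\<integral>y. jensen_integrand k n x A \<delta> l j y \<partial>lborel) =
    of_real (2 * \<delta>) * (p_reg_gf k (exp (- of_real x)) * exp (of_nat n * of_real x)) *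
      (\<integral>u. scaled_integrand k n x A \<delta> l j u \<partial>lborel)"
proof -
  define N where "N = p_reg_gf k (exp (- of_real x)) * exp (of_nat n * of_real x)"
  have "N \<noteq> 0"
    using p_reg_gf_of_real_nonzero[of "exp (- x)" k] assms by (simp add: N_def exp_of_real[symmetric])
  then have eq: "jensen_integrand k n x A \<delta> l j (2 * \<delta> * u) = N * scaled_integrand k n x A \<delta> l j u" for u
    unfolding scaled_integrand_eq_jensen_integrand N_def by simp
  have "(\<integral>y. jensen_integrand k n x A \<delta> l j y \<partial>lborel) =
      (2 * \<delta>) *\<^sub>R (\<integral>u. jensen_integrand k n x A \<delta> l j (2 * \<delta> * u) \<partial>lborel)"
    using assms lborel_integral_real_affine[of "2 * \<delta>" "jensen_integrand k n x A \<delta> l j" 0] by simp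
  also have "\<dots> = of_real (2 * \<delta>) * N * (\<integral>u. scaled_integrand k n x A \<delta> l j u \<partial>lborel)"
    unfolding eq by (simp add: scaleR_conv_of_real)
  finally show ?thesis by (simp only: N_def)
qed

lemma integral_scaled_integrand_tendsto:
  fixes k d :: nat
  assumes k: "k \<ge> 2"
  shows "(\<lambda>n. \<integral>u. scaled_integrand k n (saddle k n) (A_reg k d n) (delta_reg k n) l j u \<partial>lborel) \<longlonglongrightarrow>
    of_real (sqrt pi * (fact l * (if even l then (-1) ^ (l div 2) / fact (l div 2) else 0)))"
proof -
  define c where "c = 4 * pi\<^sup>2 * m_reg k"
  \<comment> \<open>Half of the limit 1 / (4 c) of \<delta>^2 / x^3, so that \<kappa> x^3 \<le>
    \<delta>^2 holds for large n.\<close>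
  define \<kappa> where "\<kappa> = 1 / (8 * c)"
  have c: "c > 0" using m_reg_pos[OF k] by (simp add: c_def)
  then have \<kappa>: "\<kappa> > 0" by (simp add: \<kappa>_def)
  let ?x = "saddle k" and ?A = "A_reg k d" and ?\<delta> = "delta_reg k"
  let ?s = "\<lambda>n u. scaled_integrand k n (?x n) (?A n) (?\<delta> n) l j u"
  have pos: "\<forall>\<^sub>F n in sequentially. ?x n > 0 \<and> ?\<delta> n > 0 \<and> real n * (?x n)\<^sup>2 = c"
    using delta_reg_asymp(2)[OF k] eventually_gt_at_top[of 0]
    by eventually_elim (auto simp: saddle_pos[OF k] saddle_square[OF k] c_def)
  have lim: "(\<lambda>n. ?s n u) \<longlonglongrightarrow> of_real (exp (- u\<^sup>2)) * (- 2 * \<i> * of_real u) ^ l" for u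
    using scaled_integrand_tendsto[OF k pos c_def saddle_tendsto _ A_reg_saddle[OF k]] delta_reg_saddle[OF k]
    by (simp add: c_def)
  obtain B where B: "\<And>n x A \<delta> u. 0 < x \<Longrightarrow> x \<le> 1 \<Longrightarrow> 0 < \<delta> \<Longrightarrow> \<delta> \<le> 1 \<Longrightarrow> \<kappa> * x ^ 3 \<le> \<delta>\<^sup>2 \<Longrightarrow> \<bar>x - A\<bar> \<le> \<delta> \<Longrightarrow>
    norm (scaled_integrand k n x A \<delta> l j u) \<le> B * (1 / (1 + u\<^sup>2))"
    using scaled_integrand_bound[OF k \<kappa>] by blast
  have ev: "\<forall>\<^sub>F n in sequentially. 0 < ?x n \<and> 0 < ?\<delta> n \<and> (\<forall>u. norm (?s n u) \<le> B * (1 / (1 + u\<^sup>2)))"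
  proof -
    have e1: "\<forall>\<^sub>F n in sequentially. ?x n < 1"
      using saddle_tendsto by (rule order_tendstoD) simp
    have "\<forall>\<^sub>F n in sequentially. \<kappa> < (?\<delta> n)\<^sup>2 / ?x n ^ 3"
    proof (rule order_tendstoD(1)[OF delta_reg_saddle[OF k]])
      have "\<kappa> < 1 / (4 * c)" using c by (simp add: \<kappa>_def field_simps)
      then show "\<kappa> < 1 / (4 * (4 * pi\<^sup>2 * m_reg k))" by (simp only: c_def)
    qed
    moreover have "\<forall>\<^sub>F n in sequentially. (?\<delta> n)\<^sup>2 < 1"
    proof -
      have "(\<lambda>n. (?\<delta> n)\<^sup>2 / ?x n ^ 3 * ?x n ^ 3) \<longlonglongrightarrow> 1 / (4 * (4 * pi\<^sup>2 * m_reg k)) * 0 ^ 3"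
        by (intro tendsto_mult tendsto_power delta_reg_saddle saddle_tendsto k)
      then have "\<forall>\<^sub>F n in sequentially. (?\<delta> n)\<^sup>2 / ?x n ^ 3 * ?x n ^ 3 < 1"
        by (rule order_tendstoD) simp
      then show ?thesis using pos by eventually_elim simp
    qed
    moreover have "\<forall>\<^sub>F n in sequentially. \<bar>(?x n - ?A n) / ?\<delta> n\<bar> < 1"
      using tendsto_rabs[OF A_reg_saddle[OF k]] by (rule order_tendstoD) simp
    ultimately show ?thesis using e1 pos
    proof eventually_elim
      case (elim n)
      then have "?\<delta> n \<le> 1" using power_less_imp_less_base[of "?\<delta> n" 2 1] by simp
      moreover have "\<kappa> * ?x n ^ 3 \<le> (?\<delta> n)\<^sup>2"
        using elim by (simp add: pos_less_divide_eq)
      moreover have "\<bar>?x n - ?A n\<bar> \<le> ?\<delta> n"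
        using elim by (simp add: abs_divide pos_divide_less_eq)
      ultimately show ?case
        using elim B[of "?x n" "?\<delta> n" "?A n" n] by simp
    qed
  qed
  then obtain n0 where n0: "\<And>n. n \<ge> n0 \<Longrightarrow> 0 < ?x n \<and> 0 < ?\<delta> n \<and> (\<forall>u. norm (?s n u) \<le> B * (1 / (1 + u\<^sup>2)))"
    unfolding eventually_sequentially by blast
  \<comment> \<open>Dominated convergence asks for the majorant at every index, whereas it holds
    only from \<open>n0\<close> on; hence the shift.\<close>
  have "(\<lambda>n. \<integral>u. ?s (n + n0) u \<partial>lborel) \<longlonglongrightarrow> (\<integral>u. of_real (exp (- u\<^sup>2)) * (- 2 * \<i> * of_real u) ^ l \<partial>lborel)"
  proof (rule integral_dominated_convergence)
    show "integrable lborel (\<lambda>u. B * (1 / (1 + u\<^sup>2)))"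
      by (intro integrable_mult_right integrable_inverse_one_plus_square)
    show "(\<lambda>u. complex_of_real (exp (- u\<^sup>2)) * (- 2 * \<i> * of_real u) ^ l) \<in> borel_measurable lborel"
      by measurable
    show "?s (n + n0) \<in> borel_measurable lborel" for n
    proof -
      have p: "?x (n + n0) > 0" "?\<delta> (n + n0) > 0" using n0[of "n + n0"] by auto
      have "jensen_integrand k (n + n0) (?x (n + n0)) (?A (n + n0)) (?\<delta> (n + n0)) l j \<in> borel_measurable borel"
        using integrable_jensen_integrand[OF p(1)] borel_measurable_integrable by force
      then show ?thesis
        unfolding scaled_integrand_eq_jensen_integrand[abs_def] by measurable
    qed
    show "AE u in lborel. (\<lambda>n. ?s (n + n0) u) \<longlonglongrightarrow> of_real (exp (- u\<^sup>2)) * (- 2 * \<i> * of_real u) ^ l"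
      using lim by (intro always_eventually allI LIMSEQ_ignore_initial_segment)
    show "AE u in lborel. norm (?s (n + n0) u) \<le> B * (1 / (1 + u\<^sup>2))" for n
      using n0[of "n + n0"] by (intro always_eventually allI) auto
  qed
  then show ?thesis
    unfolding gaussian_moment_complex by (rule LIMSEQ_offset)
qed

lemma uniform_limit_sum:
  fixes f :: "'i \<Rightarrow> 'n \<Rightarrow> 'a \<Rightarrow> 'b :: real_normed_vector"
  assumes "\<And>i. i \<in> I \<Longrightarrow> uniform_limit S (f i) (g i) F"
  shows "uniform_limit S (\<lambda>n x. \<Sum>i\<in>I. f i n x) (\<lambda>x. \<Sum>i\<in>I. g i x) F"
  using assms by (induction I rule: infinite_finite_induct) (auto intro!: uniform_limit_add uniform_limit_const)

theorem theorem1p1: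
  fixes k d :: nat and K :: "real set"
  assumes "k \<ge> 2" and "d \<ge> 1" and "compact K"
  shows "uniform_limit K (\<lambda>n x. poly (renorm_jensen_poly k d n) x)
           (\<lambda>x. poly (hermite_poly d) x) sequentially"
proof -
  note k = assms(1)
  define I where "I n l j = (\<integral>u. scaled_integrand k n (saddle k n) (A_reg k d n) (delta_reg k n) l j u \<partial>lborel)" for n l j
  define g where "g l = (fact l * (if even l then (-1) ^ (l div 2) / fact (l div 2) else 0) :: real)" for l
  have I: "(\<lambda>n. I n l j) \<longlonglongrightarrow> of_real (sqrt pi * g l)" for l j
    unfolding I_def g_def by (rule integral_scaled_integrand_tendsto[OF k])
  \<comment> \<open>The renormalized polynomial is real, so taking real parts of the coefficients
    loses nothing and spares a proof that the integrals are real.\<close>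
  have "(\<lambda>n. Re (I n l j / I n 0 0)) \<longlonglongrightarrow> Re (of_real (sqrt pi * g l) / of_real (sqrt pi * g 0))" for l j
    by (intro tendsto_Re tendsto_divide I) (simp add: g_def)
  then have coeff: "(\<lambda>n. Re (I n l j / I n 0 0)) \<longlonglongrightarrow> g l" for l j
    by (simp add: g_def[of 0] flip: of_real_divide)
  \<comment> \<open>X occurs only in the finitely many monomials, which are bounded on the compact
    set, so convergence of the coefficients is uniform in X.\<close>
  have "uniform_limit K (\<lambda>n X. \<Sum>j\<le>d. real (d choose j) * X ^ j * Re (I n (d - j) j / I n 0 0))
      (\<lambda>X. \<Sum>j\<le>d. real (d choose j) * X ^ j * g (d - j)) sequentially"
  proof (intro uniform_limit_sum uniform_lim_mult uniform_limit_const)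
    fix j
    show "uniform_limit K (\<lambda>n X. Re (I n (d - j) j / I n 0 0)) (\<lambda>X. g (d - j)) sequentially"
      using coeff[of "d - j" j] by (auto simp: uniform_limit_iff tendsto_iff elim!: eventually_mono)
    show "bounded ((\<lambda>X. real (d choose j)) ` K)" "bounded ((\<lambda>X. X ^ j) ` K)"
      "bounded ((\<lambda>X. real (d choose j) * X ^ j) ` K)"
      by (intro compact_imp_bounded compact_continuous_image continuous_intros assms(3))+
    show "bounded ((\<lambda>X. g (d - j)) ` K)"
      by (auto intro: bounded_subset[of "{g (d - j)}"])
  qed
  also have "(\<lambda>X. \<Sum>j\<le>d. real (d choose j) * X ^ j * g (d - j)) = (\<lambda>x. poly (hermite_poly d) x)"
    by (simp add: fun_eq_iff poly_hermite_poly_sum g_def)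
  finally show ?thesis
  proof (rule uniform_limit_cong[THEN iffD1, rotated 2])
    show "\<forall>\<^sub>F n in sequentially. \<forall>X\<in>K. (\<Sum>j\<le>d. real (d choose j) * X ^ j * Re (I n (d - j) j / I n 0 0)) =
        poly (renorm_jensen_poly k d n) X"
      using delta_reg_asymp(2)[OF k] eventually_gt_at_top[of 0]
    proof eventually_elim
      case (elim n)
      have x: "saddle k n > 0" using elim by (simp add: saddle_pos[OF k])
      define N where "N = p_reg_gf k (exp (- of_real (saddle k n))) * exp (of_nat n * of_real (saddle k n))"
      \<comment> \<open>The Jacobian 2 \<delta> and the value at y = 0 are shared by numerator and
        denominator; being nonzero, they cancel.\<close>
      have N: "of_real (2 * delta_reg k n) * N \<noteq> 0"
        using p_reg_gf_of_real_nonzero[of "exp (- saddle k n)" k] x elim by (simp add: N_def exp_of_real[symmetric])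
      show ?case
      proof
        fix X
        have "complex_of_real (poly (renorm_jensen_poly k d n) X) =
            (\<Sum>j\<le>d. of_nat (d choose j) * of_real X ^ j *
              ((of_real (2 * delta_reg k n) * N * I n (d - j) j) / (of_real (2 * delta_reg k n) * N * I n 0 0)))"
          using poly_renorm_jensen_poly_eq[OF x, of k n d X] elim
          unfolding integral_jensen_integrand[OF x elim(1)] N_def I_def by simp
        also have "\<dots> = (\<Sum>j\<le>d. of_real (real (d choose j) * X ^ j) * (I n (d - j) j / I n 0 0))"
          unfolding mult_divide_mult_cancel_left[OF N] by simp
        finally have "poly (renorm_jensen_poly k d n) X =
            Re (\<Sum>j\<le>d. of_real (real (d choose j) * X ^ j) * (I n (d - j) j / I n 0 0))"
          by (metis Re_complex_of_real)
        then show "(\<Sum>j\<le>d. real (d choose j) * X ^ j * Re (I n (d - j) j / I n 0 0)) = poly (renorm_jensen_poly k d n) X"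
          by (simp only: Re_sum times_complex.simps Re_complex_of_real Im_complex_of_real) simp
      qed
    qed
  qed auto
qed

end
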